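(* Consider the equal-mass zero-angular-momentum three-body problem with $1/r^2$ potential, and let $i\ne j$ be two of the letters $1,2,3$. If a nonstuttering syzygy sequence ends (respectively begins) with $ijij\ldots$, then any bounded solution which realizes this sequence must end (respectively begin) in the $ij$ collision. The untied sequences $\ldots ijij\ldots$ (bi-infinite, alternating between two letters) are not realized by any bounded solution.
   Context: Three equal masses $m_1=m_2=m_3>0$ have positions $x=(x_1,x_2,x_3)$, $x_i\in\mathbb{R}^2$, with $\sum m_ix_i=0$ for all time. Put $r_{ij}=|x_i-x_j|$ and $U=\sum_{i<j} m_im_j/r_{ij}^2$. Newton's equations of the $1/r^2$ problem are $\ddot x_i=-2\sum_{j\ne i}m_j(x_i-x_j)/r_{ij}^4$; solutions are taken on their maximal interval of existence and have zero angular momentum, $\sum m_ix_i\wedge\dot x_i=0$. The energy is $H=\frac12\sum m_i|\dot x_i|^2-U$ and the moment of inertia is $I=\sum_i m_i|x_i|^2$. A solution is called bounded if $H=0$ and $I$ is constant along it. A syzygy is a collinear configuration of the three bodies that is not a collision. It is of type $1$, $2$ or $3$ according to which mass lies between the other two. If the syzygy times of a solution are discrete, its syzygy sequence is the list of the types of its syzygies in temporal order, considered up to shift of the index. A solution realizes a sequence if its syzygy sequence is that sequence. A syzygy sequence, i.e. a sequence $\{s_k\}_{k\in\mathbb{Z}}$ with $s_k\in\{1,2,3\}$, is nonstuttering if $s_k\ne s_{k+1}$ for all $k$. It ends (begins) with $ijij\ldots$ if there is $N$ such that $s_k\in\{i,j\}$ for all $k>N$ (for all $k<N$). A solution ends (begins)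 in the $ij$ collision if $r_{ij}(t)\to0$ as $t$ tends to the right (left) endpoint of its maximal interval of existence. *)

theory Defs
  imports "HOL-Analysis.Analysis"
begin

text \<open>
  The letters (and the bodies) are the elements of the type \<open>3\<close>, in which the literal \<open>3\<close>
  denotes the same element as \<open>0\<close>; hence the order of that type is never used below.
\<close>

type_synonym configuration = "(real^2)^3"

definition collision_free :: "configuration \<Rightarrow> bool" where
  "collision_free q \<longleftrightarrow> (\<forall>i j. i \<noteq> j \<longrightarrow> q $ i \<noteq> q $ j)"

definition acceleration :: "(3 \<Rightarrow> real) \<Rightarrow> configuration \<Rightarrow> configuration" where
  "acceleration m q =
     (\<chi> i. - 2 *\<^sub>R (\<Sum>j\<in>UNIV - {i}. (m j / dist (q $ i) (q $ j) ^ 4) *\<^sub>R (q $ i - q $ j)))"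

definition potential :: "(3 \<Rightarrow> real) \<Rightarrow> configuration \<Rightarrow> real" where
  "potential m q =
     m 1 * m 2 / (dist (q $ 1) (q $ 2))\<^sup>2 +
     m 1 * m 3 / (dist (q $ 1) (q $ 3))\<^sup>2 +
     m 2 * m 3 / (dist (q $ 2) (q $ 3))\<^sup>2"

definition energy :: "(3 \<Rightarrow> real) \<Rightarrow> configuration \<Rightarrow> configuration \<Rightarrow> real" where
  "energy m q v = 1/2 * (\<Sum>i\<in>UNIV. m i * (norm (v $ i))\<^sup>2) - potential m q"

definition moment_of_inertia :: "(3 \<Rightarrow> real) \<Rightarrow> configuration \<Rightarrow> real" where
  "moment_of_inertia m q = (\<Sum>i\<in>UNIV. m i * (norm (q $ i))\<^sup>2)"

definition wedge :: "real^2 \<Rightarrow> real^2 \<Rightarrow> real" where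
  "wedge u w = u $ 1 * w $ 2 - u $ 2 * w $ 1"

definition angular_momentum :: "(3 \<Rightarrow> real) \<Rightarrow> configuration \<Rightarrow> configuration \<Rightarrow> real" where
  "angular_momentum m q v = (\<Sum>i\<in>UNIV. m i * wedge (q $ i) (v $ i))"

definition velocity :: "(real \<Rightarrow> configuration) \<Rightarrow> real \<Rightarrow> configuration" where
  "velocity x t = vector_derivative x (at t)"

text \<open>
  A motion is a function on all of \<open>\<real>\<close>, of which only the values on the nonempty open time
  interval with (possibly infinite) endpoints \<open>a\<close> and \<open>b\<close> are relevant.
\<close>

definition newton_solution :: "(3 \<Rightarrow> real) \<Rightarrow> ereal \<Rightarrow> ereal \<Rightarrow> (real \<Rightarrow> configuration) \<Rightarrow> bool" where
  "newton_solution m a b x \<longleftrightarrow> a < b \<and>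
     (\<forall>t\<in>einterval a b. collision_free (x t) \<and>
        (x has_vector_derivative velocity x t) (at t) \<and>
        (velocity x has_vector_derivative acceleration m (x t)) (at t))"

definition maximal_solution :: "(3 \<Rightarrow> real) \<Rightarrow> ereal \<Rightarrow> ereal \<Rightarrow> (real \<Rightarrow> configuration) \<Rightarrow> bool" where
  "maximal_solution m a b x \<longleftrightarrow> newton_solution m a b x \<and>
     (\<forall>a' b' y. newton_solution m a' b' y \<and> a' \<le> a \<and> b \<le> b' \<and>
        (\<forall>t\<in>einterval a b. y t = x t) \<longrightarrow> a' = a \<and> b' = b)"

definition centered_zero_am_solution ::
    "(3 \<Rightarrow> real) \<Rightarrow> ereal \<Rightarrow> ereal \<Rightarrow> (real \<Rightarrow> configuration) \<Rightarrow> bool" where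
  "centered_zero_am_solution m a b x \<longleftrightarrow> maximal_solution m a b x \<and>
     (\<forall>t\<in>einterval a b. (\<Sum>i\<in>UNIV. m i *\<^sub>R x t $ i) = 0 \<and>
        angular_momentum m (x t) (velocity x t) = 0)"

definition bounded_solution :: "(3 \<Rightarrow> real) \<Rightarrow> ereal \<Rightarrow> ereal \<Rightarrow> (real \<Rightarrow> configuration) \<Rightarrow> bool" where
  "bounded_solution m a b x \<longleftrightarrow> centered_zero_am_solution m a b x \<and>
     (\<forall>t\<in>einterval a b. energy m (x t) (velocity x t) = 0) \<and>
     (\<lambda>t. moment_of_inertia m (x t)) constant_on einterval a b"

definition syzygy :: "configuration \<Rightarrow> bool" where
  "syzygy q \<longleftrightarrow> collinear {q $ 1, q $ 2, q $ 3} \<and> collision_free q"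

definition syzygy_of_type :: "3 \<Rightarrow> configuration \<Rightarrow> bool" where
  "syzygy_of_type k q \<longleftrightarrow> syzygy q \<and>
     (\<forall>i j. i \<noteq> j \<and> i \<noteq> k \<and> j \<noteq> k \<longrightarrow> between (q $ i, q $ j) (q $ k))"

definition syzygy_times :: "ereal \<Rightarrow> ereal \<Rightarrow> (real \<Rightarrow> configuration) \<Rightarrow> real set" where
  "syzygy_times a b x = {t \<in> einterval a b. syzygy (x t)}"

text \<open>
  The enumeration \<open>\<tau>\<close> of the syzygy times is unique only up to a shift of its index, so quantifying
  over it existentially identifies sequences that differ by a shift.
\<close>

definition realizes :: "ereal \<Rightarrow> ereal \<Rightarrow> (real \<Rightarrow> configuration) \<Rightarrow> (int \<Rightarrow> 3) \<Rightarrow> bool" where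
  "realizes a b x s \<longleftrightarrow> discrete (syzygy_times a b x) \<and>
     (\<exists>\<tau> :: int \<Rightarrow> real. strict_mono \<tau> \<and> range \<tau> = syzygy_times a b x \<and>
        (\<forall>k. syzygy_of_type (s k) (x (\<tau> k))))"

definition nonstuttering :: "(int \<Rightarrow> 3) \<Rightarrow> bool" where
  "nonstuttering s \<longleftrightarrow> (\<forall>k. s k \<noteq> s (k + 1))"

definition ends_with :: "3 \<Rightarrow> 3 \<Rightarrow> (int \<Rightarrow> 3) \<Rightarrow> bool" where
  "ends_with i j s \<longleftrightarrow> (\<exists>N. \<forall>k>N. s k \<in> {i, j})"

definition begins_with :: "3 \<Rightarrow> 3 \<Rightarrow> (int \<Rightarrow> 3) \<Rightarrow> bool" where
  "begins_with i j s \<longleftrightarrow> (\<exists>N. \<forall>k<N. s k \<in> {i, j})"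

definition untied :: "3 \<Rightarrow> 3 \<Rightarrow> (int \<Rightarrow> 3) \<Rightarrow> bool" where
  "untied i j s \<longleftrightarrow> nonstuttering s \<and> (\<forall>k. s k \<in> {i, j})"

text \<open>
  The time variable is taken in the extended reals so that a finite and an infinite endpoint of
  the interval are treated alike; \<open>real_of_ereal\<close> is composed only with arguments near the
  endpoint and inside the interval, where it is the identity.
\<close>

definition ends_in_collision :: "3 \<Rightarrow> 3 \<Rightarrow> ereal \<Rightarrow> (real \<Rightarrow> configuration) \<Rightarrow> bool" where
  "ends_in_collision i j b x \<longleftrightarrow>
     (((\<lambda>t. dist (x t $ i) (x t $ j)) \<circ> real_of_ereal) \<longlongrightarrow> 0) (at_left b)"

definition begins_in_collision :: "3 \<Rightarrow> 3 \<Rightarrow> ereal \<Rightarrow> (real \<Rightarrow> configuration) \<Rightarrow> bool" where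
  "begins_in_collision i j a x \<longleftrightarrow>
     (((\<lambda>t. dist (x t $ i) (x t $ j)) \<circ> real_of_ereal) \<longlongrightarrow> 0) (at_right a)"

end

theory Submission
  imports Defs
begin

text \<open>
  Zero angular momentum, zero energy and constant moment of inertia make the shape of the triangle
  move along geodesics of a Jacobi metric on the sphere of shapes. Place bodies \<open>i\<close> and \<open>j\<close> at
  \<open>1\<close> and \<open>-1\<close>; the position \<open>w\<close> of the body \<open>k\<close> is then a conformal coordinate of the shape. The
  \<open>ij\<close> collision is \<open>w = \<infinity>\<close>, the collinear shapes are the real line, and those of type \<open>k\<close> form the
  slit \<open>{-1..1}\<close>. A syzygy sequence with letters \<open>i\<close> and \<open>j\<close> only keeps \<open>w\<close> off the slit, and
  because it does not stutter, \<open>w\<close> crosses the two remaining rays alternately, that is, it winds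
  around the slit.

  Off the slit put \<open>w = cosh \<zeta>\<close> with \<open>\<zeta> = \<sigma> + \<i> \<eta>\<close> and \<open>\<sigma> > 0\<close>. The level sets of \<open>\<sigma>\<close> are the
  ellipses with foci \<open>1\<close> and \<open>-1\<close>, on which
  \<open>cosh \<sigma> = (r\<^sub>i\<^sub>k + r\<^sub>j\<^sub>k) / r\<^sub>i\<^sub>j\<close>. In the coordinate \<open>\<zeta>\<close> the Jacobi metric is
  \<open>E \<bar>d\<zeta>\<bar>\<^sup>2\<close>, and in a time \<open>s\<close> with \<open>\<bar>d\<zeta>/ds\<bar>\<^sup>2 = E\<close> its geodesics obey
  \<open>\<zeta>'' = \<nabla>E / 2\<close>. The decisive fact, \<open>radial_force\<close>, is that \<open>E\<close> is strictly decreasing in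
  \<open>\<sigma>\<close> everywhere off the slit, so \<open>\<sigma>\<close> is a positive, strictly concave function of \<open>s\<close>.

  Each passage between the two rays changes \<open>cos \<eta> = (r\<^sub>j\<^sub>k - r\<^sub>i\<^sub>k) / r\<^sub>i\<^sub>j\<close> by \<open>2\<close> or \<open>-2\<close>, and as
  long as \<open>\<sigma>\<close> is bounded the speed of \<open>cos \<eta>\<close> with respect to \<open>s\<close> is bounded, so infinitely many
  passages take infinite time \<open>s\<close>. If \<open>d\<sigma>/ds\<close> were negative at some time, \<open>\<sigma>\<close> would be bounded from
  then on, and its concavity would carry it below \<open>0\<close>. So \<open>d\<sigma>/ds \<ge> 0\<close> throughout. If \<open>\<sigma>\<close> were bounded,
  the strict concavity would be uniform and make \<open>d\<sigma>/ds\<close> negative. Hence \<open>\<sigma> \<rightarrow> \<infinity>\<close>, and \<open>r\<^sub>i\<^sub>j \<rightarrow> 0\<close>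
  because the moment of inertia bounds the other distances. Backward in time the same argument
  gives \<open>\<sigma> \<rightarrow> \<infinity>\<close> and \<open>d\<sigma>/ds \<le> 0\<close>. For an untied sequence both signs hold at all times, which is
  impossible as \<open>d\<sigma>/ds\<close> is strictly decreasing.

  The argument is carried out in the physical time \<open>t\<close>: \<open>escape_of_concave_coordinate\<close> states it for
  functions of \<open>t\<close> with \<open>ds/dt = g\<close>, and \<open>shape_of_equal_mass_motion\<close> is the reduction of Newton's
  equations to the \<open>w\<close>-plane.
\<close>


section \<open>Elliptic coordinates on the shape plane\<close>

text \<open>
  For \<open>w = cosh (\<sigma> + \<i> \<eta>)\<close> with \<open>\<sigma> \<ge> 0\<close> one has \<open>\<bar>w - 1\<bar> = cosh \<sigma> - cos \<eta>\<close> and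
  \<open>\<bar>w + 1\<bar> = cosh \<sigma> + cos \<eta>\<close>. This gives \<open>cosh \<sigma>\<close>, \<open>cos \<eta>\<close>, \<open>sinh \<sigma>\<close> and \<open>sin \<eta>\<close> as functions of
  \<open>w\<close> without choosing a branch of \<open>\<eta>\<close>.
\<close>

definition cosh_coord :: "complex \<Rightarrow> real" where
  "cosh_coord w = (cmod (w - 1) + cmod (w + 1)) / 2"

definition cos_coord :: "complex \<Rightarrow> real" where
  "cos_coord w = (cmod (w + 1) - cmod (w - 1)) / 2"

definition sinh_coord :: "complex \<Rightarrow> real" where
  "sinh_coord w = sqrt ((cosh_coord w)\<^sup>2 - 1)"

definition sin_coord :: "complex \<Rightarrow> real" where
  "sin_coord w = Im w / sinh_coord w"

text \<open>
  This is \<open>sinh (\<sigma> + \<i> \<eta>)\<close>, the branch of \<open>sqrt (w\<^sup>2 - 1)\<close> that is smooth off the slit \<open>{-1..1}\<close>.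
  Since \<open>d\<zeta> = dw / sinh \<zeta>\<close>, dividing a velocity by it gives the velocity in the coordinate \<open>\<zeta>\<close>.
\<close>

definition joukowski_root :: "complex \<Rightarrow> complex" where
  "joukowski_root w = Complex (sinh_coord w * cos_coord w) (cosh_coord w * sin_coord w)"

text \<open>
  In the triangle with vertices \<open>1\<close>, \<open>-1\<close> and \<open>w\<close>, with unit masses, the moment of inertia about the
  center of mass is \<open>2/3\<close> times this factor.
\<close>

definition inertia_factor :: "complex \<Rightarrow> real" where
  "inertia_factor w = 3 + (cmod w)\<^sup>2"

text \<open>
  Up to a constant this is \<open>ds/dt\<close>, where \<open>s\<close> is the time for which \<open>\<bar>d\<zeta>/ds\<bar>\<^sup>2\<close> equals the conformal
  factor of the Jacobi metric in the coordinate \<open>\<zeta>\<close>.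
\<close>

definition clock_rate :: "complex \<Rightarrow> real" where
  "clock_rate w = (inertia_factor w)\<^sup>2 / (cmod (w - 1) * cmod (w + 1))"

text \<open>
  For unit masses at \<open>1\<close>, \<open>-1\<close> and \<open>w\<close> these are the potential and the contribution of the forces to
  the second derivative of \<open>w\<close>; the summands \<open>1/4\<close> come from the pair at distance \<open>2\<close>.
\<close>

definition shape_potential :: "complex \<Rightarrow> real" where
  "shape_potential w = 1/4 + 1 / (cmod (w - 1))\<^sup>2 + 1 / (cmod (w + 1))\<^sup>2"

definition shape_force :: "complex \<Rightarrow> complex" where
  "shape_force w = w * (1/4 - (w - 1) / cmod (w - 1) ^ 4 + (w + 1) / cmod (w + 1) ^ 4)
     - 3 * ((w - 1) / cmod (w - 1) ^ 4 + (w + 1) / cmod (w + 1) ^ 4)"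

lemma cosh_cos_coord:
  shows "cmod (w - 1) = cosh_coord w - cos_coord w" and "cmod (w + 1) = cosh_coord w + cos_coord w"
  by (simp_all add: cosh_coord_def cos_coord_def field_simps)

lemma elliptic_coordinates:
  shows "Re w = cosh_coord w * cos_coord w"
    and "(Im w)\<^sup>2 = ((cosh_coord w)\<^sup>2 - 1) * (1 - (cos_coord w)\<^sup>2)"
    and "(cmod w)\<^sup>2 = (cosh_coord w)\<^sup>2 + (cos_coord w)\<^sup>2 - 1"
proof -
  define C c where Cc: "C = cosh_coord w" "c = cos_coord w"
  have 1: "(C - c)\<^sup>2 = (Re w - 1)\<^sup>2 + (Im w)\<^sup>2" "(C + c)\<^sup>2 = (Re w + 1)\<^sup>2 + (Im w)\<^sup>2"
    unfolding Cc cosh_cos_coord[symmetric] by (simp_all add: cmod_power2)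
  have R: "Re w = C * c" using 1 by (simp add: power2_eq_square algebra_simps)
  have I: "(Im w)\<^sup>2 = (C\<^sup>2 - 1) * (1 - c\<^sup>2)" using 1 unfolding R by algebra
  show "Re w = cosh_coord w * cos_coord w" "(Im w)\<^sup>2 = ((cosh_coord w)\<^sup>2 - 1) * (1 - (cos_coord w)\<^sup>2)"
    using R I by (simp_all add: Cc)
  show "(cmod w)\<^sup>2 = (cosh_coord w)\<^sup>2 + (cos_coord w)\<^sup>2 - 1"
    unfolding cmod_power2 I R Cc[symmetric] by algebra
qed

lemma coord_bounds: "1 \<le> cosh_coord w" "\<bar>cos_coord w\<bar> \<le> 1"
proof -
  have "cmod 2 \<le> cmod (w + 1) + cmod (w - 1)"
    using norm_triangle_ineq4[of "w + 1" "w - 1"] by simp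
  then show "1 \<le> cosh_coord w" by (simp add: cosh_coord_def)
  have "\<bar>cmod (w + 1) - cmod (w - 1)\<bar> \<le> cmod 2"
    using norm_triangle_ineq3[of "w + 1" "w - 1"] by simp
  then show "\<bar>cos_coord w\<bar> \<le> 1" by (simp add: cos_coord_def)
qed

context
  fixes w :: complex
  assumes off_slit: "cosh_coord w > 1"
begin

lemma sinh_coord_pos: "sinh_coord w > 0" and sinh_coord_sq: "(sinh_coord w)\<^sup>2 = (cosh_coord w)\<^sup>2 - 1"
  using off_slit by (simp_all add: sinh_coord_def one_less_power)

lemma foci_distances_pos: "cmod (w - 1) > 0" "cmod (w + 1) > 0"
  using off_slit coord_bounds(2)[of w] unfolding cosh_cos_coord by linarith+

lemma Im_eq_sinh_sin: "Im w = sinh_coord w * sin_coord w"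
  using sinh_coord_pos by (simp add: sin_coord_def)

lemma sin_coord_sq: "(sin_coord w)\<^sup>2 = 1 - (cos_coord w)\<^sup>2"
  using elliptic_coordinates(2)[of w] sinh_coord_pos
  unfolding sinh_coord_sq[symmetric] sin_coord_def by (simp add: power_divide)

lemma joukowski_root_square: "(joukowski_root w)\<^sup>2 = w\<^sup>2 - 1"
proof (rule complex_eqI)
  show "Re ((joukowski_root w)\<^sup>2) = Re (w\<^sup>2 - 1)"
    using sinh_coord_sq sin_coord_sq
    by (simp add: joukowski_root_def Re_power2 elliptic_coordinates(1)[of w] Im_eq_sinh_sin) algebra
  show "Im ((joukowski_root w)\<^sup>2) = Im (w\<^sup>2 - 1)"
    by (simp add: joukowski_root_def Im_power2 elliptic_coordinates(1)[of w] Im_eq_sinh_sin)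
qed

lemma norm_joukowski_root: "(cmod (joukowski_root w))\<^sup>2 = cmod (w - 1) * cmod (w + 1)"
proof -
  have "w\<^sup>2 - 1 = (w - 1) * (w + 1)" by (simp add: power2_eq_square algebra_simps)
  then show ?thesis unfolding norm_power[symmetric] joukowski_root_square by (simp add: norm_mult)
qed

lemma joukowski_root_nonzero: "joukowski_root w \<noteq> 0"
  using norm_joukowski_root foci_distances_pos by auto

lemma coord_times_cnj_root:
  "w * cnj (joukowski_root w) = Complex (cosh_coord w * sinh_coord w) (- cos_coord w * sin_coord w)"
proof (rule complex_eqI)
  show "Re (w * cnj (joukowski_root w)) = Re (Complex (cosh_coord w * sinh_coord w) (- cos_coord w * sin_coord w))"
    using sin_coord_sq by (simp add: joukowski_root_def elliptic_coordinates(1)[of w] Im_eq_sinh_sin) algebra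
  show "Im (w * cnj (joukowski_root w)) = Im (Complex (cosh_coord w * sinh_coord w) (- cos_coord w * sin_coord w))"
    using sinh_coord_sq by (simp add: joukowski_root_def elliptic_coordinates(1)[of w] Im_eq_sinh_sin) algebra
qed

lemma root_times_cnj_focal:
  "joukowski_root w * cnj (w - 1) = complex_of_real (cmod (w - 1)) * Complex (sinh_coord w) (- sin_coord w)"
  "joukowski_root w * cnj (w + 1) = complex_of_real (cmod (w + 1)) * Complex (sinh_coord w) (sin_coord w)"
proof -
  have "joukowski_root w * cnj w = Complex (cosh_coord w * sinh_coord w) (cos_coord w * sin_coord w)"
    using arg_cong[OF coord_times_cnj_root, of cnj] by (simp add: mult.commute complex_eq_iff)
  then show "joukowski_root w * cnj (w - 1) = complex_of_real (cmod (w - 1)) * Complex (sinh_coord w) (- sin_coord w)"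
    "joukowski_root w * cnj (w + 1) = complex_of_real (cmod (w + 1)) * Complex (sinh_coord w) (sin_coord w)"
    unfolding cosh_cos_coord[of w]
    by (simp_all add: ring_distribs)
       (simp_all add: complex_eq_iff joukowski_root_def cosh_cos_coord[of w] algebra_simps)
qed

text \<open>
  Up to a positive factor the left-hand side is the \<open>\<sigma>\<close>-derivative of the conformal factor of the
  Jacobi metric. With \<open>C = cosh \<sigma>\<close>, \<open>c = cos \<eta>\<close> and \<open>D = C\<^sup>2 - c\<^sup>2\<close> it equals \<open>sinh \<sigma>\<close> times
  \<open>C (2 c\<^sup>2 D\<^sup>2 + 2 D\<^sup>2 - 32 c\<^sup>2 - 8 (C\<^sup>2 + c\<^sup>2)\<^sup>2) / (4 D\<^sup>3)\<close>, and the last square wins because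
  \<open>c\<^sup>2 \<le> 1\<close> and \<open>D \<le> C\<^sup>2 + c\<^sup>2\<close>.
\<close>

lemma radial_force:
  "Re (((inertia_factor w * shape_potential w) * (cnj (w / (w\<^sup>2 - 1)) - 2 * w / inertia_factor w)
       + shape_force w) * cnj (joukowski_root w))
   \<le> - sinh_coord w * cosh_coord w / (cmod (w - 1) * cmod (w + 1))"
proof -
  define C c S where d: "C = cosh_coord w" "c = cos_coord w" "S = sinh_coord w"
  define D Q V where D: "D = (C - c) * (C + c)" "Q = C\<^sup>2 + c\<^sup>2 + 2"
    "V = 1/4 + 1 / (C - c)\<^sup>2 + 1 / (C + c)\<^sup>2"
  define n where "n = joukowski_root w"
  have S: "S > 0" "S\<^sup>2 = C\<^sup>2 - 1" using sinh_coord_pos sinh_coord_sq by (simp_all add: d)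
  have pos: "C - c > 0" "C + c > 0" using foci_distances_pos unfolding cosh_cos_coord d by auto
  then have Dpos: "D > 0" unfolding D by simp
  have Q: "Q > 0" unfolding D by (simp add: add_nonneg_pos)
  have w_n: "Re (w * cnj n) = C * S" unfolding n_def coord_times_cnj_root d by simp
  have iw_n: "Re (cnj (w / (w\<^sup>2 - 1)) * cnj n) = C * S / D"
  proof -
    have "cnj (w / (w\<^sup>2 - 1)) * cnj n = cnj (w / n)"
      using joukowski_root_nonzero unfolding joukowski_root_square[symmetric] n_def[symmetric]
      by (simp add: power2_eq_square)
    also have "Re \<dots> = Re (w * cnj n) / (cmod n)\<^sup>2" by (simp add: complex_div_cnj[of w n])
    finally show ?thesis
      using norm_joukowski_root w_n by (simp add: n_def cosh_cos_coord D d(1,2) del: times_complex.sel)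
  qed
  have m1: "Re ((w - 1) * cnj n) = S * (C - c)" and p1: "Re ((w + 1) * cnj n) = S * (C + c)"
    using root_times_cnj_focal[THEN arg_cong, of Re] unfolding cosh_cos_coord[of w] n_def[symmetric] d[symmetric]
    by (simp_all add: algebra_simps)
  have wm1: "Re (w * (w - 1) * cnj n) = (C - c) * S * (C * c - 2 + c\<^sup>2) + S * (C - c)"
    and wp1: "Re (w * (w + 1) * cnj n) = (C + c) * S * (C * c + 2 - c\<^sup>2) - S * (C + c)"
  proof -
    have sp: "Re (w * w * cnj n) = S * ((C * c)\<^sup>2 * c - S\<^sup>2 * (1 - c\<^sup>2) * c + 2 * C * c * C * (1 - c\<^sup>2))"
      unfolding mult.assoc n_def coord_times_cnj_root
      using sin_coord_sq sinh_coord_sq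
      by (simp add: elliptic_coordinates(1)[of w] Im_eq_sinh_sin d) algebra
    have "Re (w * (w - 1) * cnj n) = Re (w * w * cnj n) - C * S"
      "Re (w * (w + 1) * cnj n) = Re (w * w * cnj n) + C * S"
      by (simp_all only: w_n[symmetric] minus_complex.sel[symmetric] plus_complex.sel[symmetric])
         (simp_all add: algebra_simps)
    then show "Re (w * (w - 1) * cnj n) = (C - c) * S * (C * c - 2 + c\<^sup>2) + S * (C - c)"
      "Re (w * (w + 1) * cnj n) = (C + c) * S * (C * c + 2 - c\<^sup>2) - S * (C + c)"
      unfolding sp S(2) by algebra+
  qed
  have F: "Re (shape_force w * cnj n) =
     C * S / 4 - ((C - c) * S * (C * c - 2 + c\<^sup>2) + 4 * (S * (C - c))) / (C - c) ^ 4
     + ((C + c) * S * (C * c + 2 - c\<^sup>2) - 4 * (S * (C + c))) / (C + c) ^ 4"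
  proof -
    have "shape_force w * cnj n = w * cnj n / 4
        - (w * (w - 1) * cnj n + 3 * ((w - 1) * cnj n)) / complex_of_real ((C - c) ^ 4)
        + (w * (w + 1) * cnj n - 3 * ((w + 1) * cnj n)) / complex_of_real ((C + c) ^ 4)"
      unfolding shape_force_def cosh_cos_coord d(1,2)
      by (simp add: diff_divide_distrib add_divide_distrib algebra_simps)
    also have "Re \<dots> = Re (w * cnj n) / 4
        - (Re (w * (w - 1) * cnj n) + 3 * Re ((w - 1) * cnj n)) / (C - c) ^ 4
        + (Re (w * (w + 1) * cnj n) - 3 * Re ((w + 1) * cnj n)) / (C + c) ^ 4"
      by (simp only: minus_complex.sel plus_complex.sel Re_divide_of_real Re_divide_numeral) simp
    also have "\<dots> = C * S / 4 - ((C - c) * S * (C * c - 2 + c\<^sup>2) + 4 * (S * (C - c))) / (C - c) ^ 4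
     + ((C + c) * S * (C * c + 2 - c\<^sup>2) - 4 * (S * (C + c))) / (C + c) ^ 4"
      unfolding w_n wm1 wp1 m1 p1 by (simp add: algebra_simps)
    finally show ?thesis .
  qed
  define K where "K = Q * V * (C / D - 2 * C / Q) + C / 4
      - (C * c + 2 + c\<^sup>2) / (C - c) ^ 3 + (C * c - 2 - c\<^sup>2) / (C + c) ^ 3"
  have K: "Re (((inertia_factor w * shape_potential w) * (cnj (w / (w\<^sup>2 - 1)) - 2 * w / inertia_factor w)
       + shape_force w) * cnj n) = S * K"
  proof -
    have IQ: "inertia_factor w = Q" and IV: "shape_potential w = V"
      unfolding inertia_factor_def shape_potential_def cosh_cos_coord elliptic_coordinates(3) D d by simp_all
    have "((Q * V) * (cnj (w / (w\<^sup>2 - 1)) - 2 * w / Q) + shape_force w) * cnj n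
       = complex_of_real (Q * V) * (cnj (w / (w\<^sup>2 - 1)) * cnj n - of_real (2 / Q) * (w * cnj n)) + shape_force w * cnj n"
      by (simp add: algebra_simps)
    also have "Re \<dots> = Q * V * (C * S / D - 2 / Q * (C * S)) + Re (shape_force w * cnj n)"
    proof -
      have "Re (complex_of_real x * (p - complex_of_real y * q) + r) = x * (Re p - y * Re q) + Re r"
        for x y p q r by simp
      then show ?thesis by (simp only: iw_n w_n)
    qed
    also have "\<dots> = S * K"
    proof -
      have x: "(x * S * y + 4 * (S * x)) / x ^ 4 = S * (y + 4) / x ^ 3"
        "(x * S * y - 4 * (S * x)) / x ^ 4 = S * (y - 4) / x ^ 3" if "x > 0" for x y
        using that by (simp_all add: field_simps power4_eq_xxxx power3_eq_cube)
      show ?thesis unfolding F K_def x(1)[OF pos(1)] x(2)[OF pos(2)] by (simp add: algebra_simps add_divide_distrib diff_divide_distrib)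
    qed
    finally show ?thesis unfolding IQ IV .
  qed
  have K2: "K = C * (2 * c\<^sup>2 * D\<^sup>2 + 2 * D\<^sup>2 - 32 * c\<^sup>2 - 8 * (C\<^sup>2 + c\<^sup>2)\<^sup>2) / (4 * D ^ 3)"
  proof -
    have r1: "x / y = 4 * x * z / (4 * y * z)" and r2: "x / z = 4 * x * y / (4 * y * z)"
      if "y > 0" "z > 0" for x y z :: real
      using that by (simp_all add: field_simps)
    have "Q * V * (C / D - 2 * C / Q) = V * C * (Q / D - 2)" using Q by (simp add: field_simps)
    then have "K = V * C * (Q / D - 2) + C / 4
      - (C * c + 2 + c\<^sup>2) / (C - c) ^ 3 + (C * c - 2 - c\<^sup>2) / (C + c) ^ 3" unfolding K_def by simp
    also have "V * C * (Q / D - 2) = C * ((C - c)\<^sup>2 * (C + c)\<^sup>2 + 4 * (C + c)\<^sup>2 + 4 * (C - c)\<^sup>2)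
        * (Q - 2 * D) / (4 * (C - c) ^ 3 * (C + c) ^ 3)"
    proof -
      have "V = ((C - c)\<^sup>2 * (C + c)\<^sup>2 + 4 * (C + c)\<^sup>2 + 4 * (C - c)\<^sup>2) / (4 * (C - c)\<^sup>2 * (C + c)\<^sup>2)"
        unfolding D using pos by (simp add: add_divide_distrib)
      moreover have "Q / D - 2 = (Q - 2 * D) / ((C - c) * (C + c))"
        using Dpos by (simp add: D(1)[symmetric] field_simps)
      ultimately show ?thesis by (simp add: power2_eq_square power3_eq_cube mult_ac)
    qed
    also have "C / 4 = C * (C - c) ^ 3 * (C + c) ^ 3 / (4 * (C - c) ^ 3 * (C + c) ^ 3)"
      using pos by simp
    also have "(C * c + 2 + c\<^sup>2) / (C - c) ^ 3
        = 4 * (C * c + 2 + c\<^sup>2) * (C + c) ^ 3 / (4 * (C - c) ^ 3 * (C + c) ^ 3)"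
      by (rule r1) (use pos in auto)
    also have "(C * c - 2 - c\<^sup>2) / (C + c) ^ 3
        = 4 * (C * c - 2 - c\<^sup>2) * (C - c) ^ 3 / (4 * (C - c) ^ 3 * (C + c) ^ 3)"
      by (rule r2) (use pos in auto)
    also have "x / z + y / z - x' / z + y' / z = (x + y - x' + y') / z" for x y x' y' z :: real
      by (simp add: add_divide_distrib diff_divide_distrib)
    also have "C * ((C - c)\<^sup>2 * (C + c)\<^sup>2 + 4 * (C + c)\<^sup>2 + 4 * (C - c)\<^sup>2) * (Q - 2 * D)
        + C * (C - c) ^ 3 * (C + c) ^ 3 - 4 * (C * c + 2 + c\<^sup>2) * (C + c) ^ 3
        + 4 * (C * c - 2 - c\<^sup>2) * (C - c) ^ 3
      = C * (2 * c\<^sup>2 * D\<^sup>2 + 2 * D\<^sup>2 - 32 * c\<^sup>2 - 8 * (C\<^sup>2 + c\<^sup>2)\<^sup>2)"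
      unfolding D by algebra
    finally show ?thesis by (simp add: D(1) power_mult_distrib mult_ac)
  qed
  have "c\<^sup>2 \<le> 1" using coord_bounds(2)[of w] by (simp add: d abs_square_le_1)
  then have "c\<^sup>2 * D\<^sup>2 \<le> D\<^sup>2" by (simp add: mult_left_le_one_le)
  moreover have "D\<^sup>2 \<le> (C\<^sup>2 + c\<^sup>2)\<^sup>2"
  proof -
    have "D = C\<^sup>2 - c\<^sup>2" unfolding D by algebra
    then show ?thesis using Dpos by (intro power_mono) auto
  qed
  ultimately have "2 * c\<^sup>2 * D\<^sup>2 + 2 * D\<^sup>2 - 32 * c\<^sup>2 - 8 * (C\<^sup>2 + c\<^sup>2)\<^sup>2 \<le> - 4 * D\<^sup>2"
    using zero_le_power2[of c] by linarith
  then have "K \<le> C * (- 4 * D\<^sup>2) / (4 * D ^ 3)"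
    unfolding K2 using Dpos off_slit d(1) by (intro divide_right_mono mult_left_mono) auto
  also have "\<dots> = - C / D" using Dpos by (simp add: field_simps power2_eq_square power3_eq_cube)
  finally have "S * K \<le> S * (- C / D)" using S(1) by (intro mult_left_mono) auto
  then show ?thesis unfolding K n_def[symmetric] by (simp add: cosh_cos_coord D d[symmetric])
qed

end

section \<open>Elliptic coordinates along a curve\<close>

lemma cmod_has_real_derivative:
  assumes "(f has_vector_derivative f') (at t)" "f t \<noteq> 0"
  shows "((\<lambda>t. cmod (f t)) has_real_derivative Re (f' * cnj (f t)) / cmod (f t)) (at t)"
proof -
  have [derivative_intros]: "((\<lambda>t. Re (f t)) has_real_derivative Re f') (at t)"
    "((\<lambda>t. Im (f t)) has_real_derivative Im f') (at t)"
    using assms(1) unfolding has_vector_derivative_complex_iff by auto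
  have "(Re (f t))\<^sup>2 + (Im (f t))\<^sup>2 > 0"
    using assms(2) by (simp add: complex_eq_iff sum_power2_gt_zero_iff)
  then have "((\<lambda>t. sqrt ((Re (f t))\<^sup>2 + (Im (f t))\<^sup>2)) has_real_derivative
      (2 * (Re f' * Re (f t) + Im f' * Im (f t))) / (2 * sqrt ((Re (f t))\<^sup>2 + (Im (f t))\<^sup>2))) (at t)"
    by (auto intro!: derivative_eq_intros simp: field_simps)
  then show ?thesis unfolding cmod_def
    by (rule DERIV_cong) (subst mult_divide_mult_cancel_left, simp_all)
qed

lemma has_vector_derivative_quotient:
  fixes f g :: "real \<Rightarrow> complex"
  assumes "(f has_vector_derivative f') (at t)" "(g has_vector_derivative g') (at t)" "g t \<noteq> 0"
  shows "((\<lambda>t. f t / g t) has_vector_derivative (f' - f t / g t * g') / g t) (at t)"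
  using has_derivative_divide'[OF assms[unfolded has_vector_derivative_def]]
  unfolding has_vector_derivative_def
  by (rule has_derivative_eq_rhs)
     (use assms(3) in \<open>simp add: fun_eq_iff scaleR_conv_of_real field_simps\<close>)

text \<open>
  The derivatives below are expressed by \<open>v\<close>, the velocity \<open>d\<zeta>/dt\<close> in the coordinate \<open>\<zeta>\<close>, and are
  those of \<open>cosh \<sigma>\<close>, \<open>cos \<eta>\<close>, \<open>sinh \<sigma>\<close>, \<open>sin \<eta>\<close> and \<open>sinh \<zeta>\<close>.
\<close>

context
  fixes w :: "real \<Rightarrow> complex" and w' v :: complex and t :: real
  assumes off: "cosh_coord (w t) > 1"
    and dw: "(w has_vector_derivative w') (at t)"
    and v: "w' = joukowski_root (w t) * v"
begin

lemma foci_distances_derivative: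
  "((\<lambda>t. cmod (w t - 1)) has_real_derivative
     sinh_coord (w t) * Re v + sin_coord (w t) * Im v) (at t)"
  "((\<lambda>t. cmod (w t + 1)) has_real_derivative
     sinh_coord (w t) * Re v - sin_coord (w t) * Im v) (at t)"
proof -
  have pos: "w t - 1 \<noteq> 0" "w t + 1 \<noteq> 0" using foci_distances_pos[OF off] by auto
  have "((\<lambda>t. w t - 1) has_vector_derivative w') (at t)" "((\<lambda>t. w t + 1) has_vector_derivative w') (at t)"
    using dw by (auto intro!: derivative_eq_intros)
  note der = cmod_has_real_derivative[OF this(1) pos(1)] cmod_has_real_derivative[OF this(2) pos(2)]
  have "w' * cnj (w t - 1) = complex_of_real (cmod (w t - 1)) * (Complex (sinh_coord (w t)) (- sin_coord (w t)) * v)"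
    "w' * cnj (w t + 1) = complex_of_real (cmod (w t + 1)) * (Complex (sinh_coord (w t)) (sin_coord (w t)) * v)"
    unfolding v mult.assoc[symmetric] root_times_cnj_focal[OF off, symmetric]
    by (simp_all add: ac_simps)
  then have "Re (w' * cnj (w t - 1)) / cmod (w t - 1) = sinh_coord (w t) * Re v + sin_coord (w t) * Im v"
    "Re (w' * cnj (w t + 1)) / cmod (w t + 1) = sinh_coord (w t) * Re v - sin_coord (w t) * Im v"
    using pos by (simp_all del: complex_cnj_diff complex_cnj_add)
  then show "((\<lambda>t. cmod (w t - 1)) has_real_derivative
     sinh_coord (w t) * Re v + sin_coord (w t) * Im v) (at t)"
  "((\<lambda>t. cmod (w t + 1)) has_real_derivative
     sinh_coord (w t) * Re v - sin_coord (w t) * Im v) (at t)"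
    using der by simp_all
qed

lemma cosh_coord_derivative:
  "((\<lambda>t. cosh_coord (w t)) has_real_derivative sinh_coord (w t) * Re v) (at t)"
  using DERIV_cdivide[OF DERIV_add[OF foci_distances_derivative], of 2]
  unfolding cosh_coord_def by (rule DERIV_cong) simp

lemma cos_coord_derivative:
  "((\<lambda>t. cos_coord (w t)) has_real_derivative - (sin_coord (w t) * Im v)) (at t)"
  using DERIV_cdivide[OF DERIV_diff[OF foci_distances_derivative(2,1)], of 2]
  unfolding cos_coord_def by (rule DERIV_cong) simp

text \<open>
  The velocity in \<open>\<zeta>\<close> blows up at the foci \<open>w = 1\<close> and \<open>w = -1\<close>, whereas the gradient of \<open>cos_coord\<close> in
  \<open>w\<close>, half the difference of two unit vectors, stays bounded there.
\<close>

lemma cos_coord_derivative_le: "\<bar>- (sin_coord (w t) * Im v)\<bar> \<le> cmod w'"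
proof -
  have pos: "w t - 1 \<noteq> 0" "w t + 1 \<noteq> 0" using foci_distances_pos[OF off] by auto
  have "((\<lambda>t. w t - 1) has_vector_derivative w') (at t)" "((\<lambda>t. w t + 1) has_vector_derivative w') (at t)"
    using dw by (auto intro!: derivative_eq_intros)
  note der = cmod_has_real_derivative[OF this(1) pos(1)] cmod_has_real_derivative[OF this(2) pos(2)]
  have le: "\<bar>Re (w' * cnj z) / cmod z\<bar> \<le> cmod w'" if "z \<noteq> 0" for z
    using abs_Re_le_cmod[of "w' * cnj z"] that by (simp add: norm_mult field_simps)
  show ?thesis
    using DERIV_unique[OF der(1) foci_distances_derivative(1)]
      DERIV_unique[OF der(2) foci_distances_derivative(2)] le[OF pos(1)] le[OF pos(2)] by linarith
qed

lemma sinh_coord_derivative: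
  "((\<lambda>t. sinh_coord (w t)) has_real_derivative cosh_coord (w t) * Re v) (at t)"
proof -
  have "(cosh_coord (w t))\<^sup>2 - 1 > 0" using off by (simp add: one_less_power)
  then show ?thesis
    using sinh_coord_pos[OF off] unfolding sinh_coord_def[abs_def]
    by (auto intro!: derivative_eq_intros cosh_coord_derivative simp: sinh_coord_def field_simps)
qed

lemma sin_coord_derivative:
  "((\<lambda>t. sin_coord (w t)) has_real_derivative cos_coord (w t) * Im v) (at t)"
proof -
  have S: "sinh_coord (w t) > 0" using sinh_coord_pos[OF off] .
  have "((\<lambda>t. Im (w t)) has_real_derivative Im w') (at t)"
    using dw unfolding has_vector_derivative_complex_iff by auto
  moreover have "Im w' = sinh_coord (w t) * cos_coord (w t) * Im v + cosh_coord (w t) * sin_coord (w t) * Re v"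
    unfolding v joukowski_root_def by simp
  ultimately have "((\<lambda>t. Im (w t) / sinh_coord (w t)) has_real_derivative
     ((sinh_coord (w t) * cos_coord (w t) * Im v + cosh_coord (w t) * sin_coord (w t) * Re v) * sinh_coord (w t)
       - Im (w t) * (cosh_coord (w t) * Re v)) / (sinh_coord (w t) * sinh_coord (w t))) (at t)"
    using DERIV_divide[OF _ sinh_coord_derivative] S by simp
  then show ?thesis using S unfolding Im_eq_sinh_sin[OF off]
    by (simp add: sin_coord_def[abs_def] field_simps)
qed

lemma joukowski_root_derivative:
  "((\<lambda>t. joukowski_root (w t)) has_vector_derivative w t * v) (at t)"
proof -
  note [derivative_intros] = cosh_coord_derivative cos_coord_derivative
    sinh_coord_derivative sin_coord_derivative
  show ?thesis unfolding has_vector_derivative_complex_iff joukowski_root_def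
    by (auto intro!: derivative_eq_intros
        simp: elliptic_coordinates(1)[of "w t"] Im_eq_sinh_sin[OF off] algebra_simps)
qed

lemma clock_rate_derivative:
  "((\<lambda>t. clock_rate (w t)) has_real_derivative
     clock_rate (w t) * (4 * Re (w' * cnj (w t)) / inertia_factor (w t)
                          - 2 * Re (w t * v / joukowski_root (w t)))) (at t)"
proof -
  define C c S Z n where d: "C = cosh_coord (w t)" "c = cos_coord (w t)" "S = sinh_coord (w t)" "Z = sin_coord (w t)"
    "n = joukowski_root (w t)"
  define D Q where D: "D = cmod (w t - 1) * cmod (w t + 1)" "Q = inertia_factor (w t)"
  have Dpos: "D > 0" unfolding D using foci_distances_pos[OF off] by simp
  have Q: "Q > 0" unfolding D inertia_factor_def by (simp add: add_pos_nonneg)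
  have "w t * cnj n = Complex (C * S) (- c * Z)"
    unfolding d coord_times_cnj_root[OF off] ..
  then have "Re (w t * cnj n * v) = C * S * Re v + c * Z * Im v" by simp
  then have "Re (w t * v * cnj n) = C * S * Re v + c * Z * Im v" by (simp only: ac_simps)
  moreover have "Re (w t * v / n) = Re (w t * v * cnj n) / D"
    using complex_div_cnj[of "w t * v" n] norm_joukowski_root[OF off] by (simp add: d D)
  ultimately have wvn: "Re (w t * v / n) = (C * S * Re v + c * Z * Im v) / D" by simp
  have dD: "((\<lambda>t. cmod (w t - 1) * cmod (w t + 1)) has_real_derivative D * (2 * Re (w t * v / n))) (at t)"
  proof -
    have "(S * Re v + Z * Im v) * (C + c) + (S * Re v - Z * Im v) * (C - c)
        = D * (2 * Re (w t * v / n))"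
      unfolding wvn using Dpos by (simp add: field_simps)
    then show ?thesis
      using DERIV_mult[OF foci_distances_derivative]
      unfolding cosh_cos_coord[of "w t"] d[symmetric] by simp
  qed
  have dQ: "((\<lambda>t. inertia_factor (w t)) has_real_derivative 2 * Re (w' * cnj (w t))) (at t)"
  proof -
    have [derivative_intros]: "((\<lambda>t. Re (w t)) has_real_derivative Re w') (at t)"
      "((\<lambda>t. Im (w t)) has_real_derivative Im w') (at t)"
      using dw unfolding has_vector_derivative_complex_iff by auto
    show ?thesis unfolding inertia_factor_def cmod_power2
      by (auto intro!: derivative_eq_intros simp: algebra_simps)
  qed
  have "((\<lambda>t. (inertia_factor (w t))\<^sup>2 / (cmod (w t - 1) * cmod (w t + 1))) has_real_derivative
      (2 * Q * (2 * Re (w' * cnj (w t))) * D - Q\<^sup>2 * (D * (2 * Re (w t * v / n)))) / (D * D)) (at t)"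
    using DERIV_divide[OF DERIV_power[OF dQ, of 2] dD] Dpos by (simp add: D[symmetric] mult_ac)
  moreover have "(2 * Q * (2 * Re (w' * cnj (w t))) * D - Q\<^sup>2 * (D * (2 * Re (w t * v / n)))) / (D * D)
     = Q\<^sup>2 / D * (4 * Re (w' * cnj (w t)) / Q - 2 * Re (w t * v / n))"
    using Dpos Q by (simp add: field_simps power2_eq_square)
  ultimately show ?thesis unfolding clock_rate_def by (simp only: D d)
qed

end

section \<open>Escape of a concave coordinate\<close>

text \<open>
  A function that decreases at least \<open>\<epsilon>\<close> times as fast as \<open>c\<close> moves must drop whenever \<open>c\<close> swings.
  The reason, for either sign of the swing, is that
  \<open>f + \<epsilon> c\<close> and \<open>f - \<epsilon> c\<close> are both nonincreasing; the length of the time interval does not matter.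
\<close>

lemma drop_across_swing:
  fixes f f' c c' :: "real \<Rightarrow> real"
  assumes "u \<le> v"
    and df: "\<And>t. t \<in> {u..v} \<Longrightarrow> (f has_real_derivative f' t) (at t)"
    and dc: "\<And>t. t \<in> {u..v} \<Longrightarrow> (c has_real_derivative c' t) (at t)"
    and le: "\<And>t. t \<in> {u..v} \<Longrightarrow> f' t \<le> - \<epsilon> * \<bar>c' t\<bar>"
    and "\<epsilon> \<ge> 0"
  shows "f v \<le> f u - \<epsilon> * \<bar>c v - c u\<bar>"
proof -
  have aux: "f v + s * c v \<le> f u + s * c u" if "\<bar>s\<bar> = \<epsilon>" for s
  proof (rule DERIV_nonpos_imp_nonincreasing[OF \<open>u \<le> v\<close>])
    fix t assume "u \<le> t" "t \<le> v"
    then have t: "t \<in> {u..v}" by simp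
    have "((\<lambda>t. f t + s * c t) has_real_derivative f' t + s * c' t) (at t)"
      by (intro DERIV_add DERIV_cmult df dc t)
    moreover have "s * c' t \<le> \<epsilon> * \<bar>c' t\<bar>"
      using that abs_ge_self[of "s * c' t"] by (simp add: abs_mult)
    ultimately show "\<exists>y. ((\<lambda>t. f t + s * c t) has_real_derivative y) (at t) \<and> y \<le> 0"
      using le[OF t] by (intro exI[of _ "f' t + s * c' t"]) auto
  qed
  have "f v + \<epsilon> * c v \<le> f u + \<epsilon> * c u" "f v - \<epsilon> * c v \<le> f u - \<epsilon> * c u"
    using aux[of \<epsilon>] aux[of "- \<epsilon>"] \<open>\<epsilon> \<ge> 0\<close> by auto
  then show ?thesis by (auto simp: abs_if algebra_simps)
qed

text \<open>
  Here \<open>\<sigma>\<close> is a coordinate whose derivative \<open>y\<close> with respect to the time \<open>s\<close>, \<open>ds/dt = g\<close>, decreases,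
  and the swings of \<open>c\<close> mark the passing of time. If \<open>y\<close> were negative somewhere, \<open>\<sigma>\<close> would decrease
  from then on by a definite amount in every swing and become negative. If \<open>\<sigma>\<close> stayed bounded, \<open>y\<close>
  would do the same. The bounds \<open>swing\<close> and \<open>concave\<close> are local in \<open>\<sigma>\<close>, because for
  the shape coordinate neither is uniform as \<open>\<sigma> \<rightarrow> \<infinity>\<close>, nor is \<open>concave\<close> as \<open>\<sigma> \<rightarrow> 0\<close>.
\<close>

lemma escape_of_concave_coordinate:
  fixes \<sigma> y c g h c' :: "real \<Rightarrow> real" and \<tau> :: "nat \<Rightarrow> real"
  assumes ivl: "\<And>u v. u \<in> J \<Longrightarrow> v \<in> J \<Longrightarrow> {u..v} \<subseteq> J"
    and d\<sigma>: "\<And>t. t \<in> J \<Longrightarrow> (\<sigma> has_real_derivative y t * g t) (at t)"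
    and dy: "\<And>t. t \<in> J \<Longrightarrow> (y has_real_derivative h t) (at t)"
    and dc: "\<And>t. t \<in> J \<Longrightarrow> (c has_real_derivative c' t) (at t)"
    and g: "\<And>t. t \<in> J \<Longrightarrow> g t > 0"
    and pos: "\<And>t. t \<in> J \<Longrightarrow> \<sigma> t > 0"
    and swing: "\<And>L. \<exists>M>0. \<forall>t\<in>J. \<sigma> t \<le> L \<longrightarrow> \<bar>c' t\<bar> \<le> M * g t"
    and concave: "\<And>\<epsilon> L. \<epsilon> > 0 \<Longrightarrow> \<exists>\<delta>>0. \<forall>t\<in>J. \<epsilon> \<le> \<sigma> t \<and> \<sigma> t \<le> L \<longrightarrow> h t \<le> - \<delta> * g t"
    and \<tau>: "strict_mono \<tau>" "range \<tau> \<subseteq> J"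
    and alt: "\<And>n. \<bar>c (\<tau> (Suc n)) - c (\<tau> n)\<bar> = 2"
  shows "\<forall>t\<in>J. 0 \<le> y t" and "\<exists>t\<in>J. \<forall>t'\<in>J. t \<le> t' \<longrightarrow> L < \<sigma> t'"
    and "\<And>u v. u \<in> J \<Longrightarrow> v \<in> J \<Longrightarrow> u < v \<Longrightarrow> y v < y u"
proof -
  have \<tau>J: "\<tau> n \<in> J" for n using \<tau> by auto
  have hneg: "h t < 0" if tJ: "t \<in> J" for t
  proof -
    obtain \<delta> where "\<delta> > 0" and d: "\<forall>t'\<in>J. \<sigma> t \<le> \<sigma> t' \<and> \<sigma> t' \<le> \<sigma> t \<longrightarrow> h t' \<le> - \<delta> * g t'"
      using concave[OF pos[OF tJ], of "\<sigma> t"] by blast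
    have "h t \<le> - \<delta> * g t" using d that by auto
    moreover have "\<delta> * g t > 0" using \<open>\<delta> > 0\<close> g[OF that] by simp
    ultimately show ?thesis by simp
  qed
  show ydec: "y v < y u" if "u \<in> J" "v \<in> J" "u < v" for u v
    using \<open>u < v\<close>
  proof (rule DERIV_neg_imp_decreasing)
    fix t assume "u \<le> t" "t \<le> v"
    then have "t \<in> J" using ivl[OF that(1,2)] by auto
    then show "\<exists>d. (y has_real_derivative d) (at t) \<and> d < 0" using dy hneg by blast
  qed
  have ydec': "y v \<le> y u" if "u \<in> J" "v \<in> J" "u \<le> v" for u v
    using ydec[of u v] that by (cases "u = v") auto
  \<comment> \<open>The swings cannot accumulate inside \<open>J\<close>, where \<open>c\<close> is continuous.\<close>
  have beyond: "\<exists>n. t < \<tau> n" if "t \<in> J" for t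
  proof (rule ccontr)
    assume "\<nexists>n. t < \<tau> n"
    then have le: "\<tau> n \<le> t" for n by (meson not_less)
    have mono: "incseq \<tau>" using \<tau> by (simp add: strict_mono_mono)
    obtain l where l: "\<tau> \<longlonglongrightarrow> l" "\<forall>n. \<tau> n \<le> l"
      using incseq_convergent[OF mono] le by blast
    have "l \<le> t" using l(1) le by (meson LIMSEQ_le_const2)
    then have "l \<in> J" using ivl[OF \<tau>J[of 0] that] l(2) by auto
    then have "isCont c l" using dc DERIV_isCont by blast
    then have "(\<lambda>n. c (\<tau> n)) \<longlonglongrightarrow> c l"
      using l(1) isCont_tendsto_compose by blast
    then have "(\<lambda>n. \<bar>c (\<tau> (Suc n)) - c (\<tau> n)\<bar>) \<longlonglongrightarrow> \<bar>c l - c l\<bar>"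
      by (intro tendsto_intros) (rule LIMSEQ_Suc)
    then show False using alt LIMSEQ_unique[OF tendsto_const] by fastforce
  qed
  have unbounded_drop: False
    if \<epsilon>: "\<epsilon> > 0" and t0: "t0 \<in> J" and df: "\<And>t. t \<in> J \<Longrightarrow> (f has_real_derivative f' t) (at t)"
      and le: "\<And>t. t \<in> J \<Longrightarrow> t0 \<le> t \<Longrightarrow> f' t \<le> - \<epsilon> * \<bar>c' t\<bar>"
      and nonneg: "\<And>t. t \<in> J \<Longrightarrow> f t \<ge> 0" for f f' t0 \<epsilon>
  proof -
    obtain N where N: "t0 < \<tau> N" using beyond[OF t0] by blast
    have drop: "f (\<tau> (N + n)) \<le> f (\<tau> N) - 2 * \<epsilon> * real n" for n
    proof (induction n)
      case (Suc n)
      have "\<tau> N \<le> \<tau> (N + n)" using \<tau>(1) by (simp add: strict_mono_less_eq)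
      then have sub: "t \<in> J" "t0 \<le> t" if "t \<in> {\<tau> (N + n)..\<tau> (Suc (N + n))}" for t
        using ivl[OF \<tau>J[of "N + n"] \<tau>J[of "Suc (N + n)"]] that N by auto
      then have "f (\<tau> (Suc (N + n))) \<le> f (\<tau> (N + n)) - \<epsilon> * \<bar>c (\<tau> (Suc (N + n))) - c (\<tau> (N + n))\<bar>"
        using \<tau>(1) \<epsilon>
        by (intro drop_across_swing[where f' = f' and c' = c'])
           (auto simp: strict_mono_less_eq intro!: df dc le[simplified] sub)
      with Suc alt show ?case by (simp add: algebra_simps)
    qed simp
    obtain n where "f (\<tau> N) < real n * (2 * \<epsilon>)"
      using reals_Archimedean3[of "2 * \<epsilon>"] \<epsilon> by auto
    then have "f (\<tau> (N + n)) < 0" using drop[of n] by (simp add: algebra_simps)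
    then show False using nonneg[OF \<tau>J[of "N + n"]] by simp
  qed
  show ynn: "\<forall>t\<in>J. 0 \<le> y t"
  proof (intro ballI, rule ccontr)
    fix t0 assume t0: "t0 \<in> J" "\<not> 0 \<le> y t0"
    have yneg: "y t \<le> y t0" if "t \<in> J" "t0 \<le> t" for t using ydec' t0 that by blast
    have \<sigma>le: "\<sigma> t \<le> \<sigma> t0" if "t \<in> J" "t0 \<le> t" for t
      using \<open>t0 \<le> t\<close>
    proof (rule DERIV_nonpos_imp_nonincreasing)
      fix r assume "t0 \<le> r" "r \<le> t"
      then have r: "r \<in> J" "t0 \<le> r" using ivl[OF t0(1) \<open>t \<in> J\<close>] by auto
      have "y r * g r \<le> 0" using yneg[OF r] g[OF r(1)] t0 by (simp add: mult_nonpos_nonneg)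
      then show "\<exists>d. (\<sigma> has_real_derivative d) (at r) \<and> d \<le> 0" using d\<sigma>[OF r(1)] by blast
    qed
    obtain M where M: "M > 0" "\<forall>t\<in>J. \<sigma> t \<le> \<sigma> t0 \<longrightarrow> \<bar>c' t\<bar> \<le> M * g t" using swing by blast
    show False
    proof (rule unbounded_drop[of "- y t0 / M" t0 \<sigma> "\<lambda>t. y t * g t"])
      fix t assume t: "t \<in> J" "t0 \<le> t"
      have "y t * g t \<le> y t0 * g t" using yneg[OF t] g[OF t(1)] by simp
      also have "\<dots> \<le> y t0 * (\<bar>c' t\<bar> / M)"
        using M \<sigma>le[OF t] t t0
        by (intro mult_left_mono_neg) (auto simp: field_simps)
      finally show "y t * g t \<le> - (- y t0 / M) * \<bar>c' t\<bar>" by simp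
    next
      show "- y t0 / M > 0" using t0 M by (intro divide_pos_pos) auto
      show "\<sigma> t \<ge> 0" if "t \<in> J" for t using pos[OF that] by simp
    qed (use t0 d\<sigma> in auto)
  qed
  have \<sigma>mono: "\<sigma> u \<le> \<sigma> v" if "u \<in> J" "v \<in> J" "u \<le> v" for u v
    using \<open>u \<le> v\<close>
  proof (rule DERIV_nonneg_imp_nondecreasing)
    fix r assume "u \<le> r" "r \<le> v"
    then have r: "r \<in> J" using ivl[OF that(1,2)] by auto
    then have "y r * g r \<ge> 0" using ynn g[OF r] by simp
    then show "\<exists>d. (\<sigma> has_real_derivative d) (at r) \<and> d \<ge> 0" using d\<sigma>[OF r] by blast
  qed
  show "\<exists>t\<in>J. \<forall>t'\<in>J. t \<le> t' \<longrightarrow> L < \<sigma> t'"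
  proof (rule ccontr)
    assume "\<not> ?thesis"
    then have bdd: "\<sigma> t \<le> L" if "t \<in> J" for t using \<sigma>mono that by (meson not_less order_trans)
    obtain M where M: "M > 0" "\<forall>t\<in>J. \<sigma> t \<le> L \<longrightarrow> \<bar>c' t\<bar> \<le> M * g t" using swing by blast
    obtain \<delta> where \<delta>: "\<delta> > 0"
      "\<forall>t\<in>J. \<sigma> (\<tau> 0) \<le> \<sigma> t \<and> \<sigma> t \<le> L \<longrightarrow> h t \<le> - \<delta> * g t"
      using concave[OF pos[OF \<tau>J[of 0]]] by blast
    show False
    proof (rule unbounded_drop[of "\<delta> / M" "\<tau> 0" y h])
      fix t assume t: "t \<in> J" "\<tau> 0 \<le> t"
      have "\<bar>c' t\<bar> / M \<le> g t" using M bdd[OF t(1)] t(1) by (auto simp: field_simps)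
      then have "\<delta> * (\<bar>c' t\<bar> / M) \<le> \<delta> * g t" using \<delta>(1) by (intro mult_left_mono) auto
      moreover have "h t \<le> - \<delta> * g t" using \<delta>(2) t bdd \<sigma>mono \<tau>J by auto
      ultimately show "h t \<le> - (\<delta> / M) * \<bar>c' t\<bar>" by simp
    qed (use M \<delta> \<tau>J dy ynn in auto)
  qed
qed

section \<open>Shape motions off the slit\<close>

text \<open>
  The equation of motion \<open>deriv'\<close> is Newton's equation on the sphere of shapes with its round metric
  \<open>\<bar>dw\<bar>\<^sup>2 / (3 + \<bar>w\<bar>\<^sup>2)\<^sup>2\<close>, whose Christoffel symbol gives the term quadratic in \<open>w'\<close>. The equation
  \<open>speed\<close> expresses that the energy is zero.
\<close>

locale shape_motion =
  fixes w w' :: "real \<Rightarrow> complex" and J :: "real set" and \<kappa> :: real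
  assumes interval: "\<And>u v. u \<in> J \<Longrightarrow> v \<in> J \<Longrightarrow> {u..v} \<subseteq> J"
    and \<kappa>: "\<kappa> > 0"
    and deriv: "\<And>t. t \<in> J \<Longrightarrow> (w has_vector_derivative w' t) (at t)"
    and deriv': "\<And>t. t \<in> J \<Longrightarrow> (w' has_vector_derivative
        2 * cnj (w t) * (w' t)\<^sup>2 / inertia_factor (w t)
        + (\<kappa> * inertia_factor (w t))\<^sup>2 * shape_force (w t)) (at t)"
    and speed: "\<And>t. t \<in> J \<Longrightarrow> (cmod (w' t))\<^sup>2 = \<kappa>\<^sup>2 * inertia_factor (w t) ^ 3 * shape_potential (w t)"
    and off_slit: "\<And>t. t \<in> J \<Longrightarrow> cosh_coord (w t) > 1"
begin

text \<open>
  \<open>radial_velocity\<close> is \<open>d\<sigma>/ds\<close>, and \<open>radial_acceleration\<close> is its derivative with respect to \<open>t\<close>.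
\<close>

definition radial_velocity :: "real \<Rightarrow> real" where
  "radial_velocity t = Re (w' t / joukowski_root (w t)) / clock_rate (w t)"

definition radial_acceleration :: "real \<Rightarrow> real" where
  "radial_acceleration t = (\<kappa> * inertia_factor (w t))\<^sup>2 *
     Re (((inertia_factor (w t) * shape_potential (w t))
            * (cnj (w t / ((w t)\<^sup>2 - 1)) - 2 * w t / inertia_factor (w t))
          + shape_force (w t)) * cnj (joukowski_root (w t)))
     / (cmod (w t - 1) * cmod (w t + 1) * clock_rate (w t))"

definition angular_derivative :: "real \<Rightarrow> real" where
  "angular_derivative t = - (sin_coord (w t) * Im (w' t / joukowski_root (w t)))"

lemma inertia_factor_pos: "inertia_factor z > 0"
  by (simp add: inertia_factor_def add_pos_nonneg)

lemma clock_rate_pos: "t \<in> J \<Longrightarrow> clock_rate (w t) > 0"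
  using foci_distances_pos[OF off_slit, of t] inertia_factor_pos[of "w t"]
  unfolding clock_rate_def by (intro divide_pos_pos mult_pos_pos zero_less_power)

lemma w'_eq: "t \<in> J \<Longrightarrow> w' t = joukowski_root (w t) * (w' t / joukowski_root (w t))"
  using joukowski_root_nonzero[OF off_slit] by simp

lemma radial_derivative:
  assumes t: "t \<in> J"
  shows "((\<lambda>t. arcosh (cosh_coord (w t))) has_real_derivative radial_velocity t * clock_rate (w t)) (at t)"
proof -
  note off = off_slit[OF t]
  have "((\<lambda>t. arcosh (cosh_coord (w t))) has_real_derivative
      1 / sqrt ((cosh_coord (w t))\<^sup>2 - 1) * (sinh_coord (w t) * Re (w' t / joukowski_root (w t)))) (at t)"
    by (rule DERIV_chain2[OF arcosh_real_has_field_derivative[OF off]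
          cosh_coord_derivative[OF off deriv[OF t] w'_eq[OF t]]])
  then show ?thesis
    using sinh_coord_pos[OF off] clock_rate_pos[OF t]
    by (simp add: radial_velocity_def sinh_coord_def[symmetric])
qed

text \<open>
  All terms that depend on the direction of \<open>w'\<close> cancel: the quadratic term of the equation of motion
  combines with the derivatives of \<open>joukowski_root\<close> and \<open>clock_rate\<close> to a multiple of \<open>\<bar>w'\<bar>\<^sup>2\<close>, which
  the energy equation turns into a function of the shape. This is the geodesic equation
  \<open>\<zeta>'' = \<nabla>E / 2\<close>.
\<close>

lemma radial_velocity_derivative:
  assumes t: "t \<in> J"
  shows "(radial_velocity has_real_derivative radial_acceleration t) (at t)"
proof -
  note off = off_slit[OF t]
  define n v Q g where d: "n = joukowski_root (w t)" "v = w' t / n" "Q = inertia_factor (w t)" "g = clock_rate (w t)"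
  define G where "G = (\<kappa> * Q)\<^sup>2 * shape_force (w t)"
  define w'' where "w'' = 2 * cnj (w t) * (w' t)\<^sup>2 / Q + G"
  have n: "n \<noteq> 0" using joukowski_root_nonzero[OF off] by (simp add: d)
  have Q: "Q > 0" using inertia_factor_pos by (simp add: d)
  have g: "g > 0" using clock_rate_pos[OF t] by (simp add: d)
  have wv: "w' t = n * v" using n by (simp add: d)
  note wv' = wv[unfolded d(1)]
  have dr: "((\<lambda>t. w' t / joukowski_root (w t)) has_vector_derivative (w'' - v * (w t * v)) / n) (at t)"
  proof -
    have "(w' has_vector_derivative w'') (at t)"
      using deriv'[OF t] unfolding w''_def G_def d .
    from has_vector_derivative_quotient[OF this joukowski_root_derivative[OF off deriv[OF t] wv']] n
    show ?thesis unfolding d(1,2) by simp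
  qed
  define B where "B = 4 * Re (w' t * cnj (w t)) / Q - 2 * Re (w t * v / n)"
  have "(radial_velocity has_real_derivative
      (Re ((w'' - v * (w t * v)) / n) * g - Re v * (g * B)) / (g * g)) (at t)"
  proof -
    have "((\<lambda>t. Re (w' t / joukowski_root (w t))) has_real_derivative Re ((w'' - v * (w t * v)) / n)) (at t)"
      using dr unfolding has_vector_derivative_complex_iff by simp
    from DERIV_divide[OF this clock_rate_derivative[OF off deriv[OF t] wv']] g
    show ?thesis unfolding radial_velocity_def[abs_def] B_def d by simp
  qed
  also have "(Re ((w'' - v * (w t * v)) / n) * g - Re v * (g * B)) / (g * g) = Re ((w'' - v * (w t * v)) / n - v * B) / g"
    using g by (simp add: field_simps)
  \<comment> \<open>With \<open>p = w' cnj w\<close> and \<open>q = w v / n\<close> the left-hand side contains \<open>2 p - 4 Re p = - 2 cnj p\<close>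
     and \<open>2 Re q - q = cnj q\<close>, both of which are multiples of \<open>cnj w'\<close>.\<close>
  also have "(w'' - v * (w t * v)) / n - v * B
     = ((cmod (w' t))\<^sup>2 * (cnj (w t / n\<^sup>2) - 2 * w t / Q) + G) / n"
  proof -
    define p q where pq: "p = w' t * cnj (w t)" "q = w t * v / n"
    have re: "z + cnj z = complex_of_real (2 * Re z)" for z
      by (simp add: complex_eq_iff)
    have B: "complex_of_real B = 2 * (p + cnj p) / Q - (q + cnj q)"
      unfolding B_def pq[symmetric] re by simp
    have sq: "complex_of_real ((cmod (w' t))\<^sup>2) = w' t * cnj (w' t)"
      by (rule complex_norm_square)
    have "(w'' - v * (w t * v)) / n = 2 * v * p / Q + G / n - v * q"
      unfolding w''_def pq wv using n by (simp add: field_simps power2_eq_square)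
    then have "(w'' - v * (w t * v)) / n - v * B = G / n - 2 * v * cnj p / Q + v * cnj q"
      unfolding B by (simp add: algebra_simps add_divide_distrib)
    also have "v * cnj q = w' t * cnj (w' t) * cnj (w t / n\<^sup>2) / n"
      unfolding pq wv using n by (simp add: field_simps power2_eq_square)
    also have "2 * v * cnj p / Q = w' t * cnj (w' t) * (2 * w t / Q) / n"
      unfolding pq wv using n by (simp add: field_simps)
    finally show ?thesis unfolding sq by (simp add: algebra_simps add_divide_distrib diff_divide_distrib)
  qed
  also have "Re \<dots> = (\<kappa> * Q)\<^sup>2 * Re (((Q * shape_potential (w t)) * (cnj (w t / ((w t)\<^sup>2 - 1)) - 2 * w t / Q)
          + shape_force (w t)) * cnj n) / (cmod (w t - 1) * cmod (w t + 1))"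
  proof -
    define X where "X = (Q * shape_potential (w t)) * (cnj (w t / ((w t)\<^sup>2 - 1)) - 2 * w t / Q) + shape_force (w t)"
    have nsq: "n\<^sup>2 = (w t)\<^sup>2 - 1" using joukowski_root_square[OF off] by (simp add: d)
    have "(cmod (w' t))\<^sup>2 * (cnj (w t / n\<^sup>2) - 2 * w t / Q) + G = of_real ((\<kappa> * Q)\<^sup>2) * X"
      unfolding speed[OF t] G_def X_def d(3)[symmetric] nsq
      by (simp add: algebra_simps power2_eq_square power3_eq_cube)
    moreover have "Re (of_real ((\<kappa> * Q)\<^sup>2) * X / n) = (\<kappa> * Q)\<^sup>2 * (Re (X * cnj n) / (cmod n)\<^sup>2)"
    proof -
      have "of_real ((\<kappa> * Q)\<^sup>2) * X / n = of_real ((\<kappa> * Q)\<^sup>2 / (cmod n)\<^sup>2) * (X * cnj n)"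
        by (subst complex_div_cnj) simp
      moreover have "Re (complex_of_real r * z) = r * Re z" for r z by simp
      ultimately show ?thesis by (simp only:) simp
    qed
    ultimately show ?thesis
      unfolding X_def[symmetric] using norm_joukowski_root[OF off] by (simp only: d(1)) simp
  qed
  finally show ?thesis unfolding radial_acceleration_def d by simp
qed

lemma radial_acceleration_le:
  assumes t: "t \<in> J"
  shows "radial_acceleration t \<le>
     - (\<kappa>\<^sup>2 * sinh_coord (w t) * cosh_coord (w t) / (inertia_factor (w t))\<^sup>2) * clock_rate (w t)"
proof -
  note off = off_slit[OF t]
  define D Q R where d: "D = cmod (w t - 1) * cmod (w t + 1)" "Q = inertia_factor (w t)"
     "R = Re (((inertia_factor (w t) * shape_potential (w t))
            * (cnj (w t / ((w t)\<^sup>2 - 1)) - 2 * w t / inertia_factor (w t))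
          + shape_force (w t)) * cnj (joukowski_root (w t)))"
  have D: "D > 0" unfolding d using foci_distances_pos[OF off] by simp
  have Q: "Q > 0" using inertia_factor_pos by (simp add: d)
  have "radial_acceleration t = (\<kappa> * Q)\<^sup>2 * R / (D * (Q\<^sup>2 / D))"
    by (simp only: radial_acceleration_def clock_rate_def d)
  also have "\<dots> = \<kappa>\<^sup>2 * R" using D Q by (simp add: power_mult_distrib)
  also have "\<dots> \<le> \<kappa>\<^sup>2 * (- sinh_coord (w t) * cosh_coord (w t) / D)"
    using radial_force[OF off] unfolding d by (intro mult_left_mono) auto
  also have "\<dots> = - (\<kappa>\<^sup>2 * sinh_coord (w t) * cosh_coord (w t) / (inertia_factor (w t))\<^sup>2) * clock_rate (w t)"
    unfolding clock_rate_def d(1,2)[symmetric] using D Q by simp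
  finally show ?thesis .
qed

lemma cosh_coord_le: "t \<in> J \<Longrightarrow> arcosh (cosh_coord (w t)) \<le> L \<Longrightarrow> cosh_coord (w t) \<le> cosh L"
  using off_slit[of t]
  by (metis arcosh_nonneg_real cosh_arcosh_real cosh_real_nonneg_le_iff less_imp_le order_trans)

text \<open>
  The bound rests on \<open>\<bar>(cos \<eta>)'\<bar> \<le> \<bar>w'\<bar>\<close>: since \<open>clock_rate\<close> and \<open>\<bar>w'\<bar>\<close> have poles of the same order at the
  foci, their quotient is bounded on every bounded set of shapes.
\<close>

lemma swing_bound: "\<exists>M>0. \<forall>t\<in>J. arcosh (cosh_coord (w t)) \<le> L \<longrightarrow> \<bar>angular_derivative t\<bar> \<le> M * clock_rate (w t)"
proof (intro exI[of _ "\<kappa> * ((cosh L)\<^sup>2 + 2)"] conjI ballI impI)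
  show "\<kappa> * ((cosh L)\<^sup>2 + 2) > 0" using \<kappa> by (simp add: add_nonneg_pos)
  fix t assume t: "t \<in> J" and L: "arcosh (cosh_coord (w t)) \<le> L"
  note off = off_slit[OF t]
  define C c a b Q V where d: "C = cosh_coord (w t)" "c = cos_coord (w t)" "a = cmod (w t - 1)" "b = cmod (w t + 1)"
    "Q = inertia_factor (w t)" "V = shape_potential (w t)"
  have pos: "a > 0" "b > 0" using foci_distances_pos[OF off] by (simp_all add: d)
  have Q: "Q \<ge> 3" by (simp add: d inertia_factor_def)
  have ab: "a = C - c" "b = C + c" by (simp_all add: d cosh_cos_coord)
  have C: "C\<^sup>2 \<le> (cosh L)\<^sup>2" "C \<ge> 1" using cosh_coord_le[OF t L] off by (auto simp: d intro!: power_mono)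
  have c: "c\<^sup>2 \<le> 1" using coord_bounds(2) by (simp add: d abs_square_le_1)
  have D: "a * b \<le> C\<^sup>2" unfolding ab by (simp add: algebra_simps power2_eq_square)
  have "V * (a * b)\<^sup>2 = (a * b)\<^sup>2 / 4 + a\<^sup>2 + b\<^sup>2"
    unfolding d(6) shape_potential_def d(3,4)[symmetric] using pos by (simp add: field_simps)
  also have "\<dots> = (a * b)\<^sup>2 / 4 + 2 * C\<^sup>2 + 2 * c\<^sup>2" unfolding ab by algebra
  also have "\<dots> \<le> (C\<^sup>2)\<^sup>2 / 4 + 2 * C\<^sup>2 + 2 * c\<^sup>2"
    using D pos by (intro add_right_mono divide_right_mono power_mono) auto
  finally have VD': "V * (a * b)\<^sup>2 \<le> (C\<^sup>2)\<^sup>2 / 4 + 2 * C\<^sup>2 + 2 * c\<^sup>2" .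
  have "(C\<^sup>2 + 2)\<^sup>2 = (C\<^sup>2)\<^sup>2 + 4 * C\<^sup>2 + 4" by algebra
  then have VD: "V * (a * b)\<^sup>2 \<le> (C\<^sup>2 + 2)\<^sup>2"
    using VD' c zero_le_power2[of C] zero_le_power2[of "C\<^sup>2"] by linarith
  have bound: "V * (a * b)\<^sup>2 / Q \<le> ((cosh L)\<^sup>2 + 2)\<^sup>2"
  proof -
    have "V * (a * b)\<^sup>2 / Q \<le> V * (a * b)\<^sup>2 / 1"
      using Q by (intro divide_left_mono) (auto simp: d shape_potential_def)
    also have "\<dots> \<le> (C\<^sup>2 + 2)\<^sup>2" using VD by simp
    also have "\<dots> \<le> ((cosh L)\<^sup>2 + 2)\<^sup>2" using C by (intro power_mono) auto
    finally show ?thesis .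
  qed
  have "(cmod (w' t))\<^sup>2 = \<kappa>\<^sup>2 * (V * (a * b)\<^sup>2 / Q) * (Q\<^sup>2 / (a * b))\<^sup>2"
    unfolding speed[OF t] d(5,6)[symmetric] using pos Q
    by (simp add: power_mult_distrib power_divide field_simps power3_eq_cube power2_eq_square)
  also have "\<dots> \<le> \<kappa>\<^sup>2 * ((cosh L)\<^sup>2 + 2)\<^sup>2 * (Q\<^sup>2 / (a * b))\<^sup>2"
    by (intro mult_right_mono mult_left_mono bound) auto
  also have "\<dots> = (\<kappa> * ((cosh L)\<^sup>2 + 2) * clock_rate (w t))\<^sup>2"
    unfolding clock_rate_def d(3-5) by (simp only: power_mult_distrib)
  finally have "cmod (w' t) \<le> \<kappa> * ((cosh L)\<^sup>2 + 2) * clock_rate (w t)"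
    using \<kappa> clock_rate_pos[OF t] by (simp add: power2_le_iff_abs_le)
  then show "\<bar>angular_derivative t\<bar> \<le> \<kappa> * ((cosh L)\<^sup>2 + 2) * clock_rate (w t)"
    using cos_coord_derivative_le[OF off deriv[OF t] w'_eq[OF t]]
    unfolding angular_derivative_def by linarith
qed

lemma concavity_bound:
  assumes "\<epsilon> > 0"
  shows "\<exists>\<delta>>0. \<forall>t\<in>J. \<epsilon> \<le> arcosh (cosh_coord (w t)) \<and> arcosh (cosh_coord (w t)) \<le> L
           \<longrightarrow> radial_acceleration t \<le> - \<delta> * clock_rate (w t)"
proof (intro exI[of _ "\<kappa>\<^sup>2 * sinh \<epsilon> / ((cosh L)\<^sup>2 + 3)\<^sup>2"] conjI ballI impI)
  have "(cosh L)\<^sup>2 + 3 > 0" by (simp add: add_nonneg_pos)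
  then show "\<kappa>\<^sup>2 * sinh \<epsilon> / ((cosh L)\<^sup>2 + 3)\<^sup>2 > 0" using \<kappa> assms by simp
  fix t assume t: "t \<in> J" and L: "\<epsilon> \<le> arcosh (cosh_coord (w t)) \<and> arcosh (cosh_coord (w t)) \<le> L"
  note off = off_slit[OF t]
  define C c S Q where d: "C = cosh_coord (w t)" "c = cos_coord (w t)" "S = sinh_coord (w t)" "Q = inertia_factor (w t)"
  have C: "C\<^sup>2 \<le> (cosh L)\<^sup>2" "C \<ge> 1" using cosh_coord_le[OF t] L off by (auto simp: d intro!: power_mono)
  have c: "c\<^sup>2 \<le> 1" using coord_bounds(2) by (simp add: d abs_square_le_1)
  have Q: "0 < Q" "Q \<le> (cosh L)\<^sup>2 + 3"
  proof -
    have "Q = C\<^sup>2 + c\<^sup>2 + 2" using elliptic_coordinates(3)[of "w t"] by (simp add: d inertia_factor_def)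
    then show "0 < Q" "Q \<le> (cosh L)\<^sup>2 + 3"
      using C(1) c zero_le_power2[of C] zero_le_power2[of c] by linarith+
  qed
  have S: "sinh \<epsilon> \<le> S"
  proof -
    have "sinh \<epsilon> \<le> sinh (arcosh C)" using L by (simp add: d)
    also have "\<dots> = S" using off by (simp add: sinh_arcosh_real d sinh_coord_def)
    finally show ?thesis .
  qed
  have "sinh \<epsilon> \<le> S * C"
    using S C assms by (smt (verit) mult_le_cancel_left1 sinh_real_pos_iff)
  then have "\<kappa>\<^sup>2 * sinh \<epsilon> / ((cosh L)\<^sup>2 + 3)\<^sup>2 \<le> \<kappa>\<^sup>2 * (S * C) / Q\<^sup>2"
    using Q assms by (intro frac_le mult_left_mono power_mono mult_nonneg_nonneg) (use C sinh_coord_pos[OF off] in \<open>auto simp: d\<close>)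
  then have "\<kappa>\<^sup>2 * sinh \<epsilon> / ((cosh L)\<^sup>2 + 3)\<^sup>2 * clock_rate (w t) \<le> \<kappa>\<^sup>2 * (S * C) / Q\<^sup>2 * clock_rate (w t)"
    using clock_rate_pos[OF t] by (intro mult_right_mono) auto
  then show "radial_acceleration t \<le> - (\<kappa>\<^sup>2 * sinh \<epsilon> / ((cosh L)\<^sup>2 + 3)\<^sup>2) * clock_rate (w t)"
    using radial_acceleration_le[OF t] by (simp add: d mult_ac)
qed

lemma angular_deriv: "t \<in> J \<Longrightarrow>
  ((\<lambda>t. cos_coord (w t)) has_real_derivative angular_derivative t) (at t)"
  unfolding angular_derivative_def by (rule cos_coord_derivative[OF off_slit deriv w'_eq])

lemma radial_pos: "t \<in> J \<Longrightarrow> arcosh (cosh_coord (w t)) > 0"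
  using off_slit arcosh_real_strict_mono[of 1 "cosh_coord (w t)"] by simp

lemma forward_escape:
  assumes "strict_mono \<tau>" "range \<tau> \<subseteq> J"
    and "\<And>n::nat. \<bar>cos_coord (w (\<tau> (Suc n))) - cos_coord (w (\<tau> n))\<bar> = 2"
  shows "\<forall>t\<in>J. 0 \<le> radial_velocity t"
    and "\<exists>t\<in>J. \<forall>t'\<in>J. t \<le> t' \<longrightarrow> L < arcosh (cosh_coord (w t'))"
    and "\<And>u v. u \<in> J \<Longrightarrow> v \<in> J \<Longrightarrow> u < v \<Longrightarrow> radial_velocity v < radial_velocity u"
  using escape_of_concave_coordinate[OF interval radial_derivative radial_velocity_derivative
      angular_deriv clock_rate_pos radial_pos swing_bound concavity_bound assms]
  by blast+

text \<open>
  Reversing time changes the sign of \<open>d\<sigma>/ds\<close> and preserves the concavity of \<open>\<sigma>\<close>.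
\<close>

lemma backward_escape:
  assumes "strict_mono \<tau>" "range \<tau> \<subseteq> uminus ` J"
    and "\<And>n::nat. \<bar>cos_coord (w (- \<tau> (Suc n))) - cos_coord (w (- \<tau> n))\<bar> = 2"
  shows "\<forall>t\<in>J. radial_velocity t \<le> 0"
    and "\<exists>t\<in>J. \<forall>t'\<in>J. t' \<le> t \<longrightarrow> L < arcosh (cosh_coord (w t'))"
proof -
  have i: "{u..v} \<subseteq> uminus ` J" if "u \<in> uminus ` J" "v \<in> uminus ` J" for u v
  proof
    fix t assume "t \<in> {u..v}"
    then have "- t \<in> {- v..- u}" by simp
    moreover have "- v \<in> J" "- u \<in> J" using that by auto
    ultimately have "- t \<in> J" using interval by blast
    then show "t \<in> uminus ` J" by force
  qed
  have mirror: "((\<lambda>t. f (- t)) has_real_derivative - f') (at t)"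
    if "(f has_real_derivative f') (at (- t))" for f f' t
    using DERIV_mirror[of f f' t] that by simp
  have b: "\<exists>M>0. \<forall>t\<in>uminus ` J. arcosh (cosh_coord (w (- t))) \<le> L
       \<longrightarrow> \<bar>- angular_derivative (- t)\<bar> \<le> M * clock_rate (w (- t))" for L
    using swing_bound[of L] by auto
  have a: "\<exists>\<delta>>0. \<forall>t\<in>uminus ` J. \<epsilon> \<le> arcosh (cosh_coord (w (- t))) \<and> arcosh (cosh_coord (w (- t))) \<le> L
           \<longrightarrow> radial_acceleration (- t) \<le> - \<delta> * clock_rate (w (- t))" if "\<epsilon> > 0" for \<epsilon> L
    using concavity_bound[OF that, of L] by auto
  have p1: "((\<lambda>t. arcosh (cosh_coord (w (- t)))) has_real_derivative - radial_velocity (- t) * clock_rate (w (- t))) (at t)"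
    and p2: "((\<lambda>t. - radial_velocity (- t)) has_real_derivative radial_acceleration (- t)) (at t)"
    and p3: "((\<lambda>t. cos_coord (w (- t))) has_real_derivative - angular_derivative (- t)) (at t)"
    and p4: "clock_rate (w (- t)) > 0" and p5: "arcosh (cosh_coord (w (- t))) > 0"
    if "t \<in> uminus ` J" for t
    using mirror[OF radial_derivative, of t] DERIV_minus[OF mirror[OF radial_velocity_derivative, of t]]
      mirror[OF angular_deriv, of t] that clock_rate_pos[of "- t"] radial_pos[of "- t"] by auto
  note * = escape_of_concave_coordinate[where J = "uminus ` J" and \<sigma> = "\<lambda>t. arcosh (cosh_coord (w (- t)))"
      and y = "\<lambda>t. - radial_velocity (- t)" and c = "\<lambda>t. cos_coord (w (- t))" and g = "\<lambda>t. clock_rate (w (- t))"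
      and h = "\<lambda>t. radial_acceleration (- t)" and c' = "\<lambda>t. - angular_derivative (- t)" and \<tau> = \<tau>,
      OF i p1 p2 p3 p4 p5 b a assms]
  show "\<forall>t\<in>J. radial_velocity t \<le> 0"
    using *(1) by auto
  show "\<exists>t\<in>J. \<forall>t'\<in>J. t' \<le> t \<longrightarrow> L < arcosh (cosh_coord (w t'))"
    using *(2)[of L] by auto
qed

end

section \<open>Reduction of Newton's equations to the shape plane\<close>

text \<open>
  Here \<open>a\<close> is half the vector from \<open>j\<close> to \<open>i\<close>, and \<open>k\<close> lies at \<open>a w\<close> from their midpoint. The forces
  \<open>z / \<bar>z\<bar>\<^sup>4\<close> are equivariant under rotations and homogeneous, so that size and direction of \<open>a\<close> split
  off; the left-hand side is the contribution of the forces to the second derivative of \<open>w\<close>.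
\<close>

lemma shape_equation:
  fixes a w :: complex and \<mu> :: real
  assumes a: "a \<noteq> 0"
    and Ai: "Ai = - 2 * \<mu> * (2 * a / cmod (2 * a) ^ 4 + - (a * (w - 1)) / cmod (- (a * (w - 1))) ^ 4)"
    and Aj: "Aj = - 2 * \<mu> * (- (2 * a) / cmod (- (2 * a)) ^ 4 + - (a * (w + 1)) / cmod (- (a * (w + 1))) ^ 4)"
    and Ak: "Ak = - 2 * \<mu> * (a * (w - 1) / cmod (a * (w - 1)) ^ 4 + a * (w + 1) / cmod (a * (w + 1)) ^ 4)"
  shows "((Ak - (Ai + Aj) / 2) - w * ((Ai - Aj) / 2)) / a = of_real (\<mu> / cmod a ^ 4) * shape_force w"
proof -
  define A B where AB: "A = (w - 1) / complex_of_real (cmod (w - 1) ^ 4)"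
    "B = (w + 1) / complex_of_real (cmod (w + 1) ^ 4)"
  define h where "h = complex_of_real (cmod a ^ 4)"
  have h: "h \<noteq> 0" using a by (simp add: h_def)
  have 1: "2 * a / cmod (2 * a) ^ 4 = a / h / 8" "- (2 * a) / cmod (- (2 * a)) ^ 4 = - (a / h / 8)"
    by (simp_all add: norm_mult power_mult_distrib h_def)
  have 2: "a * (w - 1) / cmod (a * (w - 1)) ^ 4 = a / h * A" "a * (w + 1) / cmod (a * (w + 1)) ^ 4 = a / h * B"
    by (simp_all only: AB norm_mult power_mult_distrib h_def of_real_mult times_divide_times_eq)
  have 3: "- (a * (w - 1)) / cmod (- (a * (w - 1))) ^ 4 = - (a / h * A)"
     "- (a * (w + 1)) / cmod (- (a * (w + 1))) ^ 4 = - (a / h * B)"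
    unfolding norm_minus_cancel minus_divide_left[symmetric] 2 by simp_all
  have F: "shape_force w = w * (1/4 - A + B) - 3 * (A + B)"
    unfolding shape_force_def AB by simp
  have "(Ak - (Ai + Aj) / 2) - w * ((Ai - Aj) / 2) = a / h * (\<mu> * shape_force w)"
  proof -
    define p where "p = a / h"
    show ?thesis unfolding Ai Aj Ak 1 2 3 F p_def[symmetric] by (simp add: field_simps)
  qed
  then show ?thesis using a by (simp add: h_def)
qed

text \<open>
  Let \<open>2 a\<close> be the vector from \<open>j\<close> to \<open>i\<close> and \<open>u = a w\<close> that from their midpoint to \<open>k\<close>. Constancy of
  the moment of inertia and zero angular momentum are the real and the imaginary part of
  \<open>3 cnj a a' + cnj u u' = 0\<close>. This determines \<open>a'/a\<close> by \<open>w\<close> and \<open>w'\<close>, and so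
  eliminates size and rotation from the equation of motion; \<open>\<bar>a\<bar>\<close> is a function of \<open>w\<close> because
  \<open>3 \<bar>a\<bar>\<^sup>2 + \<bar>u\<bar>\<^sup>2 = k\<close>.
\<close>

lemma shape_of_equal_mass_motion:
  fixes Xi Xj Xk Vi Vj Vk :: "real \<Rightarrow> complex" and \<mu> k :: real
  assumes interval: "\<And>u v. u \<in> J \<Longrightarrow> v \<in> J \<Longrightarrow> {u..v} \<subseteq> J"
    and \<mu>: "\<mu> > 0" and k: "k > 0"
    and dX: "\<And>t. t \<in> J \<Longrightarrow> (Xi has_vector_derivative Vi t) (at t)"
      "\<And>t. t \<in> J \<Longrightarrow> (Xj has_vector_derivative Vj t) (at t)"
      "\<And>t. t \<in> J \<Longrightarrow> (Xk has_vector_derivative Vk t) (at t)"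
    and dVi: "\<And>t. t \<in> J \<Longrightarrow> (Vi has_vector_derivative
        - 2 * \<mu> * ((Xi t - Xj t) / cmod (Xi t - Xj t) ^ 4 + (Xi t - Xk t) / cmod (Xi t - Xk t) ^ 4)) (at t)"
    and dVj: "\<And>t. t \<in> J \<Longrightarrow> (Vj has_vector_derivative
        - 2 * \<mu> * ((Xj t - Xi t) / cmod (Xj t - Xi t) ^ 4 + (Xj t - Xk t) / cmod (Xj t - Xk t) ^ 4)) (at t)"
    and dVk: "\<And>t. t \<in> J \<Longrightarrow> (Vk has_vector_derivative
        - 2 * \<mu> * ((Xk t - Xi t) / cmod (Xk t - Xi t) ^ 4 + (Xk t - Xj t) / cmod (Xk t - Xj t) ^ 4)) (at t)"
    and ctr: "\<And>t. t \<in> J \<Longrightarrow> Xi t + Xj t + Xk t = 0" "\<And>t. t \<in> J \<Longrightarrow> Vi t + Vj t + Vk t = 0"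
    and inertia: "\<And>t. t \<in> J \<Longrightarrow> 3 * ((cmod (Xi t))\<^sup>2 + (cmod (Xj t))\<^sup>2 + (cmod (Xk t))\<^sup>2) = 2 * k"
    and momentum: "\<And>t. t \<in> J \<Longrightarrow> cnj (Xi t) * Vi t + cnj (Xj t) * Vj t + cnj (Xk t) * Vk t = 0"
    and energy: "\<And>t. t \<in> J \<Longrightarrow> ((cmod (Vi t))\<^sup>2 + (cmod (Vj t))\<^sup>2 + (cmod (Vk t))\<^sup>2) / 2
        = \<mu> * (1 / (cmod (Xi t - Xj t))\<^sup>2 + 1 / (cmod (Xi t - Xk t))\<^sup>2 + 1 / (cmod (Xj t - Xk t))\<^sup>2)"
    and apart: "\<And>t. t \<in> J \<Longrightarrow> cmod (Xi t - Xj t) < cmod (Xi t - Xk t) + cmod (Xj t - Xk t)"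
      "\<And>t. t \<in> J \<Longrightarrow> Xi t \<noteq> Xj t"
  shows "shape_motion (\<lambda>t. (2 * Xk t - Xi t - Xj t) / (Xi t - Xj t))
     (\<lambda>t. ((2 * Vk t - Vi t - Vj t) - (2 * Xk t - Xi t - Xj t) / (Xi t - Xj t) * (Vi t - Vj t)) / (Xi t - Xj t))
     J (sqrt \<mu> / k)"
    (is "shape_motion ?w ?w' J _")
proof
  show "sqrt \<mu> / k > 0" using \<mu> k by simp
next
  fix t assume t: "t \<in> J"
  define a a' u u' where d: "a = (Xi t - Xj t) / 2" "a' = (Vi t - Vj t) / 2"
    "u = Xk t - (Xi t + Xj t) / 2" "u' = Vk t - (Vi t + Vj t) / 2"
  define w w1 Q V where w: "w = ?w t" "w1 = ?w' t" "Q = inertia_factor w" "V = shape_potential w"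
  have a: "a \<noteq> 0" using apart(2)[OF t] by (simp add: d)
  have wu: "w = u / a" "u = a * w" using apart(2)[OF t] by (simp_all add: d w field_simps)
  have w1: "w1 = (u' - w * a') / a" using apart(2)[OF t] unfolding w(2) w(1)[symmetric] by (simp add: d field_simps)
  have u': "u' = a * w1 + w * a'" using a by (simp add: w1)
  have Q: "Q > 0" "Q = 3 + (cmod w)\<^sup>2" by (simp_all add: w inertia_factor_def add_pos_nonneg)
  have X: "Xi t = a - u / 3" "Xj t = - a - u / 3" "Xk t = 2 * u / 3"
    using ctr(1)[OF t] unfolding d by (simp_all add: field_simps) (algebra+)
  have Vx: "Vi t = a' - u' / 3" "Vj t = - a' - u' / 3" "Vk t = 2 * u' / 3"
    using ctr(2)[OF t] unfolding d by (simp_all add: field_simps) (algebra+)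
  have diff: "Xi t - Xj t = 2 * a" "Xj t - Xi t = - (2 * a)" "Xi t - Xk t = - (a * (w - 1))" "Xk t - Xi t = a * (w - 1)"
    "Xj t - Xk t = - (a * (w + 1))" "Xk t - Xj t = a * (w + 1)"
    unfolding X wu(2) by (simp_all add: algebra_simps)
  have norm2: "complex_of_real ((cmod z)\<^sup>2) = z * cnj z" for z by (rule complex_norm_square)
  have kQ: "(cmod a)\<^sup>2 * Q = k"
  proof -
    have "complex_of_real (2 * k) = 6 * (a * cnj a) + 2 * (u * cnj u)"
      unfolding inertia[OF t, symmetric] X of_real_mult of_real_add norm2 by (simp add: algebra_simps)
    also have "\<dots> = complex_of_real (2 * ((cmod a)\<^sup>2 * Q))"
      unfolding Q(2) wu(2) of_real_mult of_real_add norm2 by (simp add: algebra_simps)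
    finally show ?thesis unfolding of_real_eq_iff by simp
  qed
  have \<alpha>: "a' = - cnj w * a * w1 / Q"
  proof -
    have "cnj a * (3 * a' + cnj w * u') = 0"
    proof -
      have "0 = 2 * cnj a * a' + 2 / 3 * (cnj u * u')"
        using momentum[OF t] unfolding X Vx by (simp add: algebra_simps)
      then have "3 * (2 * cnj a * a' + 2 / 3 * (cnj u * u')) = 0" by simp
      then have "2 * (cnj a * (3 * a' + cnj w * u')) = 0" unfolding wu(2) by (simp add: algebra_simps)
      then show ?thesis by simp
    qed
    then have "3 * a' + cnj w * u' = 0" using a by simp
    then have "a' * of_real Q = - cnj w * a * w1"
      unfolding Q(2) of_real_add norm2 u' by (simp add: algebra_simps) algebra
    then show ?thesis using Q(1) by (simp add: field_simps)
  qed
  have \<beta>: "u' = 3 * a * w1 / Q"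
  proof -
    have "u' * of_real Q = a * w1 * of_real Q - w * cnj w * a * w1"
      unfolding u' \<alpha> using Q(1) by (simp add: field_simps)
    also have "\<dots> = 3 * a * w1"
      unfolding Q(2) of_real_add norm2 by (simp add: algebra_simps)
    finally show ?thesis using Q(1) by (simp add: field_simps)
  qed
  have \<kappa>: "(sqrt \<mu> / k * Q)\<^sup>2 = \<mu> / cmod a ^ 4"
    using a Q(1) \<mu> unfolding kQ[symmetric] by (simp add: power_divide power_mult_distrib field_simps)
  have "cmod a * 2 < cmod a * (cmod (w - 1) + cmod (w + 1))"
    using apart(1)[OF t] unfolding diff norm_minus_cancel norm_mult by (simp add: algebra_simps)
  then have "cosh_coord w > 1" using a by (simp add: cosh_coord_def mult_less_cancel_left)
  then show "cosh_coord (?w t) > 1" by (simp only: w(1))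
  have dw: "(?w has_vector_derivative ?w' t) (at t)"
    using dX[OF t] apart(2)[OF t]
    by (intro has_vector_derivative_quotient) (auto intro!: derivative_eq_intros)
  then show "(?w has_vector_derivative ?w' t) (at t)" .
  show "(cmod (?w' t))\<^sup>2 = (sqrt \<mu> / k)\<^sup>2 * inertia_factor (?w t) ^ 3 * shape_potential (?w t)"
  proof -
    have "(cmod a)\<^sup>2 * (cmod w1)\<^sup>2 / Q = (cmod a')\<^sup>2 + (cmod u')\<^sup>2 / 3"
    proof -
      have "cmod a' = cmod w * cmod a * cmod w1 / Q" "cmod u' = 3 * cmod a * cmod w1 / Q"
        unfolding \<alpha> \<beta> using Q(1) by (simp_all add: norm_mult norm_divide)
      then have "(cmod a')\<^sup>2 + (cmod u')\<^sup>2 / 3 = (cmod a)\<^sup>2 * (cmod w1)\<^sup>2 * ((cmod w)\<^sup>2 + 3) / Q\<^sup>2"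
        by (simp add: power_divide power_mult_distrib add_divide_distrib algebra_simps)
      also have "(cmod w)\<^sup>2 + 3 = Q" using Q(2) by simp
      finally show ?thesis using Q(1) by (simp add: power2_eq_square)
    qed
    also have "\<dots> = ((cmod (Vi t))\<^sup>2 + (cmod (Vj t))\<^sup>2 + (cmod (Vk t))\<^sup>2) / 2"
    proof -
      have "complex_of_real (6 * ((cmod a')\<^sup>2 + (cmod u')\<^sup>2 / 3)) = complex_of_real (3 * ((cmod (Vi t))\<^sup>2 + (cmod (Vj t))\<^sup>2 + (cmod (Vk t))\<^sup>2))"
        unfolding Vx of_real_mult of_real_add of_real_divide norm2 by (simp add: algebra_simps)
      then show ?thesis unfolding of_real_eq_iff by simp
    qed
    also have "\<dots> = \<mu> * V / (cmod a)\<^sup>2"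
      unfolding energy[OF t] diff norm_minus_cancel norm_mult w(4) shape_potential_def
      by (simp add: power_mult_distrib add_divide_distrib distrib_left mult.commute)
    finally have "(cmod w1)\<^sup>2 = \<mu> / cmod a ^ 4 * Q * V"
      using a Q(1) by (simp add: field_simps power2_eq_square power4_eq_xxxx)
    also have "\<dots> = (sqrt \<mu> / k)\<^sup>2 * Q ^ 3 * V"
      unfolding \<kappa>[symmetric] by (simp only: power_mult_distrib power2_eq_square power3_eq_cube mult_ac)
    finally show ?thesis unfolding w(4,3) by (simp only: w(1,2))
  qed
  define Ai Aj Ak where A:
    "Ai = - 2 * \<mu> * (2 * a / cmod (2 * a) ^ 4 + - (a * (w - 1)) / cmod (- (a * (w - 1))) ^ 4)"
    "Aj = - 2 * \<mu> * (- (2 * a) / cmod (- (2 * a)) ^ 4 + - (a * (w + 1)) / cmod (- (a * (w + 1))) ^ 4)"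
    "Ak = - 2 * \<mu> * (a * (w - 1) / cmod (a * (w - 1)) ^ 4 + a * (w + 1) / cmod (a * (w + 1)) ^ 4)"
  have dV: "(Vi has_vector_derivative Ai) (at t)" "(Vj has_vector_derivative Aj) (at t)" "(Vk has_vector_derivative Ak) (at t)"
    using dVi[OF t] dVj[OF t] dVk[OF t] unfolding diff A .
  have a2: "2 * a' = Vi t - Vj t" by (simp add: d)
  have num: "((\<lambda>t. (2 * Vk t - Vi t - Vj t) - ?w t * (Vi t - Vj t)) has_vector_derivative
      (2 * Ak - Ai - Aj) - (w * (Ai - Aj) + w1 * (2 * a'))) (at t)"
  proof -
    have "((\<lambda>t. ?w t * (Vi t - Vj t)) has_vector_derivative w * (Ai - Aj) + w1 * (2 * a')) (at t)"
      using has_vector_derivative_mult[OF dw has_vector_derivative_diff[OF dV(1,2)]]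
      unfolding a2 w(1,2) .
    moreover have "((\<lambda>t. 2 * Vk t - Vi t - Vj t) has_vector_derivative 2 * Ak - Ai - Aj) (at t)"
      by (intro has_vector_derivative_diff has_vector_derivative_mult_right dV)
    ultimately show ?thesis by (rule has_vector_derivative_diff[rotated])
  qed
  have "(?w' has_vector_derivative
      ((2 * Ak - Ai - Aj) - (w * (Ai - Aj) + w1 * (2 * a')) - w1 * (2 * a')) / (2 * a)) (at t)"
  proof -
    have "((\<lambda>t. Xi t - Xj t) has_vector_derivative 2 * a') (at t)"
      unfolding a2 by (intro has_vector_derivative_diff dX t)
    moreover have "Xi t - Xj t \<noteq> 0" using apart(2)[OF t] by simp
    ultimately have "((\<lambda>t. ((2 * Vk t - Vi t - Vj t) - ?w t * (Vi t - Vj t)) / (Xi t - Xj t)) has_vector_derivative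
      ((2 * Ak - Ai - Aj) - (w * (Ai - Aj) + w1 * (2 * a'))
        - ((2 * Vk t - Vi t - Vj t) - ?w t * (Vi t - Vj t)) / (Xi t - Xj t) * (2 * a')) / (Xi t - Xj t)) (at t)"
      by (rule has_vector_derivative_quotient[OF num])
    then
    show ?thesis unfolding w(2)[symmetric] unfolding diff(1) .
  qed
  moreover have "((2 * Ak - Ai - Aj) - (w * (Ai - Aj) + w1 * (2 * a')) - w1 * (2 * a')) / (2 * a)
    = ((Ak - (Ai + Aj) / 2) - w * ((Ai - Aj) / 2)) / a - 2 * w1 * (a' / a)"
  proof -
    have "(2 * Ak - Ai - Aj) - (w * (Ai - Aj) + w1 * (2 * a')) - w1 * (2 * a')
      = 2 * (((Ak - (Ai + Aj) / 2) - w * ((Ai - Aj) / 2)) - 2 * w1 * a')"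
      by (simp add: algebra_simps add_divide_distrib diff_divide_distrib)
    moreover have "(2 * (z - 2 * w1 * a')) / (2 * a) = z / a - 2 * w1 * (a' / a)" for z
      by (simp add: diff_divide_distrib)
    ultimately show ?thesis by (simp only:)
  qed
  moreover have "\<dots> = 2 * cnj w * w1\<^sup>2 / Q + (sqrt \<mu> / k * Q)\<^sup>2 * shape_force w"
    unfolding shape_equation[OF a A] \<kappa> \<alpha> using a by (simp add: power2_eq_square field_simps)
  ultimately show "(?w' has_vector_derivative 2 * cnj (?w t) * (?w' t)\<^sup>2 / inertia_factor (?w t)
     + (sqrt \<mu> / k * inertia_factor (?w t))\<^sup>2 * shape_force (?w t)) (at t)"
    unfolding w(1-3) by simp
qed (rule interval)

definition plane_point :: "real^2 \<Rightarrow> complex" where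
  "plane_point v = Complex (v $ 1) (v $ 2)"

lemma bounded_linear_plane_point: "bounded_linear plane_point"
proof -
  have "linear plane_point"
    by (rule linearI) (simp_all add: plane_point_def complex_eq_iff)
  then show ?thesis using linear_conv_bounded_linear by blast
qed

lemma plane_point_linear:
  "plane_point (u + v) = plane_point u + plane_point v"
  "plane_point (u - v) = plane_point u - plane_point v"
  "plane_point (r *\<^sub>R v) = r *\<^sub>R plane_point v"
  "plane_point 0 = 0"
  by (simp_all add: plane_point_def complex_eq_iff)

lemma cmod_plane_point: "cmod (plane_point v) = norm v"
  by (simp add: plane_point_def cmod_def norm_vec_def L2_set_def sum_2)

lemma cmod_plane_point_diff: "cmod (plane_point u - plane_point v) = dist u v"
  by (simp add: plane_point_linear(2)[symmetric] cmod_plane_point dist_norm)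

lemma Im_cnj_plane_point: "Im (cnj (plane_point u) * plane_point v) = wedge u v"
  by (simp add: plane_point_def wedge_def)

lemma UNIV_distinct_3:
  fixes i j k :: 3
  assumes "i \<noteq> j" "i \<noteq> k" "j \<noteq> k"
  shows "UNIV = {i, j, k}"
proof (rule sym, rule card_subset_eq)
  show "card {i, j, k} = CARD(3)" using assms by simp
qed simp_all

lemma third_letter: "i \<noteq> j \<Longrightarrow> \<exists>k::3. i \<noteq> k \<and> j \<noteq> k"
proof (rule ccontr)
  assume "i \<noteq> j" "\<nexists>k. i \<noteq> k \<and> j \<noteq> k"
  then have "k \<in> {i, j}" for k by (cases "k = i") auto
  then have "UNIV = {i, j}" by (simp add: set_eq_iff)
  then have "CARD(3) = card {i, j}" by simp
  then show False using \<open>i \<noteq> j\<close> by simp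
qed

lemma sum_distinct_3:
  fixes i j k :: 3 and f :: "3 \<Rightarrow> 'a::comm_monoid_add"
  assumes "i \<noteq> j" "i \<noteq> k" "j \<noteq> k"
  shows "sum f UNIV = f i + f j + f k"
  unfolding UNIV_distinct_3[OF assms] using assms by (simp add: add.assoc)

text \<open>
  The position of body \<open>k\<close> after the similarity that takes \<open>i\<close> to \<open>1\<close> and \<open>j\<close> to \<open>-1\<close>.
\<close>

definition shape :: "3 \<Rightarrow> 3 \<Rightarrow> 3 \<Rightarrow> configuration \<Rightarrow> complex" where
  "shape i j k q = (2 * plane_point (q $ k) - plane_point (q $ i) - plane_point (q $ j))
                   / (plane_point (q $ i) - plane_point (q $ j))"

lemma shape_coordinates:
  assumes "q $ i \<noteq> q $ j"
  shows "cosh_coord (shape i j k q) = (dist (q $ i) (q $ k) + dist (q $ j) (q $ k)) / dist (q $ i) (q $ j)"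
    and "cos_coord (shape i j k q) = (dist (q $ j) (q $ k) - dist (q $ i) (q $ k)) / dist (q $ i) (q $ j)"
proof -
  define a where "a = plane_point (q $ i) - plane_point (q $ j)"
  have na: "cmod a = dist (q $ i) (q $ j)" by (simp add: a_def cmod_plane_point_diff)
  then have a: "a \<noteq> 0" using assms by auto
  have "shape i j k q - 1 = 2 * (plane_point (q $ k) - plane_point (q $ i)) / a"
    "shape i j k q + 1 = 2 * (plane_point (q $ k) - plane_point (q $ j)) / a"
    using a unfolding shape_def a_def[symmetric] by (simp_all add: field_simps) (simp_all add: a_def)
  then have "cmod (shape i j k q - 1) = 2 * dist (q $ i) (q $ k) / dist (q $ i) (q $ j)"
    "cmod (shape i j k q + 1) = 2 * dist (q $ j) (q $ k) / dist (q $ i) (q $ j)"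
    by (simp_all only: norm_mult norm_divide na cmod_plane_point_diff norm_numeral)
       (simp_all add: dist_commute)
  then show "cosh_coord (shape i j k q) = (dist (q $ i) (q $ k) + dist (q $ j) (q $ k)) / dist (q $ i) (q $ j)"
    and "cos_coord (shape i j k q) = (dist (q $ j) (q $ k) - dist (q $ i) (q $ k)) / dist (q $ i) (q $ j)"
    by (simp_all add: cosh_coord_def cos_coord_def add_divide_distrib diff_divide_distrib)
qed

lemma syzygy_of_typeD:
  assumes "syzygy_of_type k q" "i \<noteq> j" "i \<noteq> k" "j \<noteq> k"
  shows "dist (q $ i) (q $ j) = dist (q $ i) (q $ k) + dist (q $ j) (q $ k)"
  using assms by (auto simp: syzygy_of_type_def between dist_commute)

lemma potential_equal_mass:
  fixes i j k :: 3 and \<mu> :: real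
  assumes "\<And>l. m l = \<mu>" "i \<noteq> j" "i \<noteq> k" "j \<noteq> k"
  shows "potential m q = \<mu>\<^sup>2 * (1 / (dist (q $ i) (q $ j))\<^sup>2 + 1 / (dist (q $ i) (q $ k))\<^sup>2 + 1 / (dist (q $ j) (q $ k))\<^sup>2)"
  using exhaust_3[of i] exhaust_3[of j] exhaust_3[of k] assms(2-)
  by (auto simp: potential_def assms(1) dist_commute power2_eq_square algebra_simps)

lemma plane_point_acceleration:
  fixes i j k :: 3 and \<mu> :: real
  assumes "\<And>l. m l = \<mu>" "i \<noteq> j" "i \<noteq> k" "j \<noteq> k"
  shows "plane_point (acceleration m q $ i) = - 2 * \<mu> *
     ((plane_point (q $ i) - plane_point (q $ j)) / cmod (plane_point (q $ i) - plane_point (q $ j)) ^ 4 + (plane_point (q $ i) - plane_point (q $ k)) / cmod (plane_point (q $ i) - plane_point (q $ k)) ^ 4)"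
proof -
  have "UNIV - {i} = {j, k}" using UNIV_distinct_3[OF assms(2-4)] assms(2-4) by auto
  then have "acceleration m q $ i = - 2 *\<^sub>R ((\<mu> / dist (q $ i) (q $ j) ^ 4) *\<^sub>R (q $ i - q $ j)
      + (\<mu> / dist (q $ i) (q $ k) ^ 4) *\<^sub>R (q $ i - q $ k))"
    using assms(4) by (simp add: acceleration_def assms(1))
  then show ?thesis
    by (simp only: plane_point_linear cmod_plane_point_diff scaleR_conv_of_real[where 'a = complex])
       (simp add: distrib_left mult.assoc)
qed

text \<open>
  On the slit \<open>k\<close> lies between \<open>i\<close> and \<open>j\<close>, which is a syzygy of a type different from \<open>i\<close> and \<open>j\<close>.
  So a stretch of the solution without such syzygies is a shape motion off the slit.
\<close>

lemma shape_motion_of_bounded_solution: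
  fixes i j k :: 3
  assumes mass: "\<And>l. m l = \<mu>" and \<mu>: "\<mu> > 0"
    and distinct: "i \<noteq> j" "i \<noteq> k" "j \<noteq> k"
    and sol: "bounded_solution m a b x"
    and J: "J \<subseteq> einterval a b" "\<And>u v. u \<in> J \<Longrightarrow> v \<in> J \<Longrightarrow> {u..v} \<subseteq> J"
    and syz: "\<And>t. t \<in> J \<Longrightarrow> syzygy (x t) \<Longrightarrow> syzygy_of_type i (x t) \<or> syzygy_of_type j (x t)"
  shows "\<exists>w' \<kappa>. shape_motion (\<lambda>t. shape i j k (x t)) w' J \<kappa>"
proof -
  define I where "I = einterval a b"
  define X V where XV: "X = (\<lambda>l t. plane_point (x t $ l))" "V = (\<lambda>l t. plane_point (velocity x t $ l))"
  have newton: "collision_free (x t)" "(x has_vector_derivative velocity x t) (at t)"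
      "(velocity x has_vector_derivative acceleration m (x t)) (at t)"
    and centered: "(\<Sum>l\<in>UNIV. m l *\<^sub>R x t $ l) = 0"
    and am: "angular_momentum m (x t) (velocity x t) = 0"
    and en: "energy m (x t) (velocity x t) = 0" if "t \<in> I" for t
    using sol that
    unfolding I_def bounded_solution_def centered_zero_am_solution_def maximal_solution_def newton_solution_def
    by auto
  obtain M where M: "\<And>t. t \<in> I \<Longrightarrow> moment_of_inertia m (x t) = M"
    using sol unfolding I_def bounded_solution_def constant_on_def by blast
  have openI: "open I" by (simp add: I_def)
  have comp: "((\<lambda>t. plane_point (y t $ l)) has_vector_derivative plane_point (y' $ l)) (at t)"
    if "(y has_vector_derivative y') (at t)" for y y' l and t :: real
    using bounded_linear.has_vector_derivative[OF
        bounded_linear_compose[OF bounded_linear_plane_point bounded_linear_vec_nth] that]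
    by (simp add: o_def)
  have dX: "(X l has_vector_derivative V l t) (at t)" if "t \<in> I" for l t
    using comp[OF newton(2)[OF that]] by (simp add: XV)
  have dV: "(V l has_vector_derivative plane_point (acceleration m (x t) $ l)) (at t)" if "t \<in> I" for l t
    using comp[OF newton(3)[OF that]] by (simp add: XV)
  have zero_deriv: "f' = 0" if "t \<in> I" "(f has_vector_derivative f') (at t)" "\<And>s. s \<in> I \<Longrightarrow> f s = c"
    for f :: "real \<Rightarrow> complex" and f' c t
  proof -
    have "((\<lambda>_. c) has_vector_derivative f') (at t)"
      by (rule has_vector_derivative_transform_within_open[OF that(2) openI that(1)]) (use that in auto)
    then show ?thesis using has_vector_derivative_const vector_derivative_unique_at by blast
  qed
  note sum3 = sum_distinct_3[OF distinct]
  have ctr: "X i t + X j t + X k t = 0" if "t \<in> I" for t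
  proof -
    have "\<mu> *\<^sub>R (x t $ i + x t $ j + x t $ k) = 0"
      using centered[OF that] by (simp add: sum3 mass scaleR_add_right)
    then have "plane_point (x t $ i + x t $ j + x t $ k) = 0" using \<mu> by (simp add: plane_point_linear(4))
    then show ?thesis by (simp add: XV plane_point_linear(1))
  qed
  have ctrV: "V i t + V j t + V k t = 0" if "t \<in> I" for t
    by (rule zero_deriv[OF that, of "\<lambda>t. X i t + X j t + X k t" _ 0])
       (auto intro!: has_vector_derivative_add dX that ctr)
  have inertia: "\<mu> * ((cmod (X i t))\<^sup>2 + (cmod (X j t))\<^sup>2 + (cmod (X k t))\<^sup>2) = M" if "t \<in> I" for t
    using M[OF that] by (simp add: moment_of_inertia_def sum3 mass XV cmod_plane_point algebra_simps)
  \<comment> \<open>The real part is half the derivative of the moment of inertia divided by \<open>\<mu>\<close>, the imaginary part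
     is the angular momentum divided by \<open>\<mu>\<close>.\<close>
  have momentum: "cnj (X i t) * V i t + cnj (X j t) * V j t + cnj (X k t) * V k t = 0" (is "?p = 0") if "t \<in> I" for t
  proof (rule complex_eqI)
    have "((\<lambda>t. cnj (X l t)) has_vector_derivative cnj (V l t)) (at t)" for l
      using bounded_linear.has_vector_derivative[OF bounded_linear_cnj dX[OF that]] .
    note d = has_vector_derivative_mult[OF this dX[OF that]]
    have "(X i t * cnj (V i t) + cnj (X i t) * V i t) + (X j t * cnj (V j t) + cnj (X j t) * V j t)
       + (X k t * cnj (V k t) + cnj (X k t) * V k t) = 0"
    proof (rule zero_deriv[OF that, of "\<lambda>t. cnj (X i t) * X i t + cnj (X j t) * X j t + cnj (X k t) * X k t" _ "of_real (M / \<mu>)"])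
      show "((\<lambda>t. cnj (X i t) * X i t + cnj (X j t) * X j t + cnj (X k t) * X k t) has_vector_derivative
        (X i t * cnj (V i t) + cnj (X i t) * V i t) + (X j t * cnj (V j t) + cnj (X j t) * V j t)
       + (X k t * cnj (V k t) + cnj (X k t) * V k t)) (at t)"
        using d by (auto intro!: has_vector_derivative_add simp: add.commute mult.commute)
      fix s assume "s \<in> I"
      have n: "cnj z * z = of_real ((cmod z)\<^sup>2)" for z
        using complex_norm_square[of z] by (simp only: mult.commute)
      have "(cmod (X i s))\<^sup>2 + (cmod (X j s))\<^sup>2 + (cmod (X k s))\<^sup>2 = M / \<mu>"
        using inertia[OF \<open>s \<in> I\<close>] \<mu> by (simp add: field_simps)
      then show "cnj (X i s) * X i s + cnj (X j s) * X j s + cnj (X k s) * X k s = of_real (M / \<mu>)"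
        unfolding n of_real_add[symmetric] by (simp only:)
    qed
    from arg_cong[OF this, of Re] show "Re ?p = Re 0" by (simp add: algebra_simps)
    have "\<mu> * Im ?p = 0"
      using am[OF that] unfolding angular_momentum_def sum3 mass Im_cnj_plane_point[symmetric] XV
      by (simp add: algebra_simps)
    then show "Im ?p = Im 0" using \<mu> by simp
  qed
  have energy: "((cmod (V i t))\<^sup>2 + (cmod (V j t))\<^sup>2 + (cmod (V k t))\<^sup>2) / 2
      = \<mu> * (1 / (cmod (X i t - X j t))\<^sup>2 + 1 / (cmod (X i t - X k t))\<^sup>2 + 1 / (cmod (X j t - X k t))\<^sup>2)"
    (is "?l = \<mu> * ?r") if "t \<in> I" for t
  proof -
    have "\<mu> * ?l = \<mu>\<^sup>2 * ?r"
      using en[OF that] unfolding energy_def potential_equal_mass[OF mass distinct] XV cmod_plane_point_diff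
      by (simp add: sum3 mass cmod_plane_point algebra_simps)
    then show ?thesis using \<mu> by (simp add: power2_eq_square)
  qed
  have neq: "X i t \<noteq> X j t" if "t \<in> I" for t
  proof -
    have "x t $ i \<noteq> x t $ j" using newton(1)[OF that] distinct by (auto simp: collision_free_def)
    then show ?thesis using cmod_plane_point_diff[of "x t $ i" "x t $ j"] by (auto simp: XV)
  qed
  have apart: "cmod (X i t - X j t) < cmod (X i t - X k t) + cmod (X j t - X k t)" if t: "t \<in> J" for t
  proof -
    have tI: "t \<in> I" using J(1) t by (auto simp: I_def)
    have "dist (x t $ i) (x t $ j) \<noteq> dist (x t $ i) (x t $ k) + dist (x t $ k) (x t $ j)"
    proof
      assume eq: "dist (x t $ i) (x t $ j) = dist (x t $ i) (x t $ k) + dist (x t $ k) (x t $ j)"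
      then have "between (x t $ i, x t $ j) (x t $ k)" by (simp add: between)
      then have "collinear {x t $ i, x t $ k, x t $ j}" by (rule between_imp_collinear)
      moreover have "{x t $ i, x t $ k, x t $ j} = {x t $ 1, x t $ 2, x t $ 3}"
      proof -
        have "($) (x t) ` {i, j, k} = ($) (x t) ` {1, 2, 3}"
          using UNIV_distinct_3[OF distinct] UNIV_3 by simp
        then show ?thesis by auto
      qed
      ultimately have "syzygy (x t)" using newton(1)[OF tI] by (simp add: syzygy_def)
      then consider "syzygy_of_type i (x t)" | "syzygy_of_type j (x t)" using syz[OF t] by blast
      then have "dist (x t $ i) (x t $ k) = 0 \<or> dist (x t $ j) (x t $ k) = 0"
      proof cases
        case 1
        from syzygy_of_typeD[OF this, of j k] eq distinct show ?thesis by (simp add: dist_commute)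
      next
        case 2
        from syzygy_of_typeD[OF this, of i k] eq distinct show ?thesis by (simp add: dist_commute)
      qed
      then show False using newton(1)[OF tI] distinct by (auto simp: collision_free_def)
    qed
    then show ?thesis unfolding XV cmod_plane_point_diff
      using dist_triangle[of "x t $ i" "x t $ j" "x t $ k"] by (simp add: dist_commute)
  qed
  show ?thesis
  proof (cases "J = {}")
    case True
    then show ?thesis by (auto simp: shape_motion_def intro: exI[of _ "1::real"])
  next
    case False
    then obtain t0 where t0: "t0 \<in> I" using J(1) by (auto simp: I_def)
    have kpos: "M / \<mu> > 0"
    proof -
      have "(cmod (X i t0))\<^sup>2 + (cmod (X j t0))\<^sup>2 + (cmod (X k t0))\<^sup>2 > 0"
    proof -
      have "(cmod (X i t0))\<^sup>2 > 0 \<or> (cmod (X j t0))\<^sup>2 > 0" using neq[OF t0] by auto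
      then show ?thesis
        using zero_le_power2[of "cmod (X i t0)"] zero_le_power2[of "cmod (X j t0)"]
          zero_le_power2[of "cmod (X k t0)"] by (elim disjE) linarith+
    qed
      then show ?thesis using inertia[OF t0] \<mu> by (metis divide_pos_pos mult_pos_pos)
    qed
    have "shape_motion (\<lambda>t. (2 * X k t - X i t - X j t) / (X i t - X j t))
     (\<lambda>t. ((2 * V k t - V i t - V j t) - (2 * X k t - X i t - X j t) / (X i t - X j t) * (V i t - V j t)) / (X i t - X j t))
     J (sqrt \<mu> / (3 / 2 * (M / \<mu>)))"
    proof (rule shape_of_equal_mass_motion)
      fix t assume "t \<in> J"
      then have t: "t \<in> I" using J(1) by (auto simp: I_def)
      show "(V i has_vector_derivative
        - 2 * \<mu> * ((X i t - X j t) / cmod (X i t - X j t) ^ 4 + (X i t - X k t) / cmod (X i t - X k t) ^ 4)) (at t)"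
        using dV[OF t, of i] unfolding plane_point_acceleration[OF mass distinct] XV .
      show "(V j has_vector_derivative
        - 2 * \<mu> * ((X j t - X i t) / cmod (X j t - X i t) ^ 4 + (X j t - X k t) / cmod (X j t - X k t) ^ 4)) (at t)"
        using dV[OF t, of j] unfolding plane_point_acceleration[OF mass distinct(1)[symmetric] distinct(3,2)] XV .
      show "(V k has_vector_derivative
        - 2 * \<mu> * ((X k t - X i t) / cmod (X k t - X i t) ^ 4 + (X k t - X j t) / cmod (X k t - X j t) ^ 4)) (at t)"
        using dV[OF t, of k] unfolding plane_point_acceleration[OF mass distinct(2,3)[symmetric] distinct(1)] XV .
      show "3 * ((cmod (X i t))\<^sup>2 + (cmod (X j t))\<^sup>2 + (cmod (X k t))\<^sup>2) = 2 * (3 / 2 * (M / \<mu>))"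
        using inertia[OF t] \<mu> by (simp add: field_simps)
    qed (use J \<mu> kpos dX ctr ctrV momentum energy apart neq in \<open>auto simp: I_def\<close>)
    then show ?thesis unfolding shape_def XV by blast
  qed
qed

section \<open>Syzygy sequences with two letters\<close>

lemma cos_coord_syzygy:
  fixes i j k :: 3
  assumes distinct: "i \<noteq> j" "i \<noteq> k" "j \<noteq> k"
  shows "syzygy_of_type i q \<Longrightarrow> cos_coord (shape i j k q) = 1"
    and "syzygy_of_type j q \<Longrightarrow> cos_coord (shape i j k q) = -1"
proof -
  have ne: "q $ i \<noteq> q $ j" if "syzygy_of_type l q" for l
    using that distinct by (auto simp: syzygy_of_type_def syzygy_def collision_free_def)
  show "cos_coord (shape i j k q) = 1" if s: "syzygy_of_type i q"
    using syzygy_of_typeD[OF s, of j k] distinct ne[OF s]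
    by (simp add: shape_coordinates dist_commute)
  show "cos_coord (shape i j k q) = -1" if s: "syzygy_of_type j q"
    using syzygy_of_typeD[OF s, of i k] distinct ne[OF s]
    by (simp add: shape_coordinates dist_commute)
qed

lemma swing_between_syzygies:
  fixes i j k :: 3
  assumes "i \<noteq> j" "i \<noteq> k" "j \<noteq> k"
    and "syzygy_of_type l q" "syzygy_of_type l' q'" "l \<in> {i, j}" "l' \<in> {i, j}" "l \<noteq> l'"
  shows "\<bar>cos_coord (shape i j k q') - cos_coord (shape i j k q)\<bar> = 2"
  using assms cos_coord_syzygy[OF assms(1-3)] by auto

lemma bounded_solution_distance:
  fixes i k :: 3
  assumes mass: "\<And>l. m l = \<mu>" and \<mu>: "\<mu> > 0" and sol: "bounded_solution m a b x"
  shows "\<exists>B>0. \<forall>t\<in>einterval a b. \<forall>i j. dist (x t $ i) (x t $ j) \<le> B"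
proof -
  obtain M where M: "\<And>t. t \<in> einterval a b \<Longrightarrow> moment_of_inertia m (x t) = M"
    using sol unfolding bounded_solution_def constant_on_def by blast
  have "norm (x t $ i) \<le> sqrt (M / \<mu>)" if "t \<in> einterval a b" for t i
  proof -
    have "\<mu> * (norm (x t $ i))\<^sup>2 \<le> (\<Sum>l\<in>UNIV. \<mu> * (norm (x t $ l))\<^sup>2)"
      using \<mu> by (intro member_le_sum) auto
    also have "\<dots> = M" using M[OF that] by (simp add: moment_of_inertia_def mass)
    finally show ?thesis using \<mu> by (intro real_le_rsqrt) (simp add: field_simps)
  qed
  then have "dist (x t $ i) (x t $ j) \<le> 2 * sqrt (M / \<mu>)" if "t \<in> einterval a b" for t i j
    using dist_triangle2[of "x t $ i" "x t $ j" 0] that by (smt (verit) dist_0_norm dist_commute)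
  then show ?thesis
    by (intro exI[of _ "max 1 (2 * sqrt (M / \<mu>))"]) (auto simp: le_max_iff_disj)
qed

text \<open>
  As \<open>cosh_coord\<close> is the quotient of \<open>r\<^sub>i\<^sub>k + r\<^sub>j\<^sub>k \<le> 2 B\<close> by \<open>r\<^sub>i\<^sub>j\<close>, its large values force \<open>r\<^sub>i\<^sub>j\<close> to be small.
  The summand \<open>1\<close> keeps the argument of \<open>arcosh\<close> in its domain.
\<close>

lemma pair_distance_small:
  assumes "q $ i \<noteq> q $ j" "dist (q $ i) (q $ k) \<le> B" "dist (q $ j) (q $ k) \<le> B"
    and "e > 0" "arcosh (2 * B / e + 1) < arcosh (cosh_coord (shape i j k q))" "B > 0"
  shows "dist (q $ i) (q $ j) < e"
proof -
  have pos: "dist (q $ i) (q $ j) > 0" using assms(1) by simp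
  have "2 * B / e + 1 < cosh_coord (shape i j k q)"
    using assms(4-6) coord_bounds(1)[of "shape i j k q"] by (subst (asm) arcosh_less_iff_real) auto
  then have "2 * B / e < 2 * B / dist (q $ i) (q $ j)"
    using assms(2,3) pos unfolding shape_coordinates(1)[OF assms(1)]
    by (smt (verit) divide_right_mono)
  then show ?thesis using assms(4,6) pos by (simp add: divide_less_cancel frac_less2 field_simps)
qed

lemma ends_in_collisionI:
  assumes "a < b"
    and "\<And>e. e > 0 \<Longrightarrow> \<exists>t0\<in>einterval a b. \<forall>t\<in>einterval a b. t0 \<le> t \<longrightarrow> dist (x t $ i) (x t $ j) < e"
  shows "ends_in_collision i j b x"
  unfolding ends_in_collision_def
proof (rule tendstoI)
  fix e :: real assume "e > 0"
  then obtain t0 where t0: "t0 \<in> einterval a b" "\<forall>t\<in>einterval a b. t0 \<le> t \<longrightarrow> dist (x t $ i) (x t $ j) < e"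
    using assms(2) by blast
  show "\<forall>\<^sub>F r in at_left b. dist (((\<lambda>t. dist (x t $ i) (x t $ j)) \<circ> real_of_ereal) r) 0 < e"
    unfolding eventually_at_left[OF assms(1)]
  proof (intro exI[of _ "ereal t0"] conjI allI impI)
    show "ereal t0 < b" using t0 by (simp add: einterval_def)
    fix r :: ereal assume r: "ereal t0 < r" "r < b"
    then obtain t where t: "r = ereal t" by (cases r) auto
    have "t \<in> einterval a b"
      using r t0(1) less_trans[of a "ereal t0" r] by (simp add: einterval_def t)
    with r t0(2) show "dist (((\<lambda>t. dist (x t $ i) (x t $ j)) \<circ> real_of_ereal) r) 0 < e"
      by (simp add: t)
  qed
qed

lemma begins_in_collisionI:
  assumes "a < b"
    and "\<And>e. e > 0 \<Longrightarrow> \<exists>t0\<in>einterval a b. \<forall>t\<in>einterval a b. t \<le> t0 \<longrightarrow> dist (x t $ i) (x t $ j) < e"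
  shows "begins_in_collision i j a x"
  unfolding begins_in_collision_def
proof (rule tendstoI)
  fix e :: real assume "e > 0"
  then obtain t0 where t0: "t0 \<in> einterval a b" "\<forall>t\<in>einterval a b. t \<le> t0 \<longrightarrow> dist (x t $ i) (x t $ j) < e"
    using assms(2) by blast
  show "\<forall>\<^sub>F r in at_right a. dist (((\<lambda>t. dist (x t $ i) (x t $ j)) \<circ> real_of_ereal) r) 0 < e"
    unfolding eventually_at_right[OF assms(1)]
  proof (intro exI[of _ "ereal t0"] conjI allI impI)
    show "a < ereal t0" using t0 by (simp add: einterval_def)
    fix r :: ereal assume r: "a < r" "r < ereal t0"
    then obtain t where t: "r = ereal t" by (cases r) auto
    have "t \<in> einterval a b"
      using r t0(1) less_trans[of r "ereal t0" b] by (simp add: einterval_def t)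
    with r t0(2) show "dist (((\<lambda>t. dist (x t $ i) (x t $ j)) \<circ> real_of_ereal) r) 0 < e"
      by (simp add: t)
  qed
qed

lemma einterval_convex: "u \<in> einterval a b \<Longrightarrow> v \<in> einterval a b \<Longrightarrow> {u..v} \<subseteq> einterval a b"
  by (auto simp: einterval_def) (metis ereal_less_eq(3) less_le_trans, metis ereal_less_eq(3) le_less_trans)

locale realized_sequence =
  fixes m :: "3 \<Rightarrow> real" and \<mu> :: real and i j k :: 3 and a b :: ereal
    and x :: "real \<Rightarrow> configuration" and s :: "int \<Rightarrow> 3" and \<tau> :: "int \<Rightarrow> real"
  assumes mass: "\<And>l. m l = \<mu>" and \<mu>: "\<mu> > 0"
    and distinct: "i \<noteq> j" "i \<noteq> k" "j \<noteq> k"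
    and sol: "bounded_solution m a b x"
    and nonstuttering: "nonstuttering s"
    and \<tau>: "strict_mono \<tau>" "range \<tau> = syzygy_times a b x"
    and types: "\<And>n. syzygy_of_type (s n) (x (\<tau> n))"
begin

lemma time_interval: "a < b"
  using sol by (simp add: bounded_solution_def centered_zero_am_solution_def maximal_solution_def newton_solution_def)

lemma \<tau>_in: "\<tau> n \<in> einterval a b"
  using \<tau>(2) by (auto simp: syzygy_times_def)

lemma no_collision: "t \<in> einterval a b \<Longrightarrow> x t $ i \<noteq> x t $ j"
  using sol distinct by (auto simp: bounded_solution_def centered_zero_am_solution_def maximal_solution_def
      newton_solution_def collision_free_def)

lemma shape_motion_while_in_pair:
  assumes J: "J \<subseteq> einterval a b" "\<And>u v. u \<in> J \<Longrightarrow> v \<in> J \<Longrightarrow> {u..v} \<subseteq> J"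
    and "\<And>n. \<tau> n \<in> J \<Longrightarrow> s n \<in> {i, j}"
  shows "\<exists>w' \<kappa>. shape_motion (\<lambda>t. shape i j k (x t)) w' J \<kappa>"
proof (rule shape_motion_of_bounded_solution[OF mass \<mu> distinct sol J])
  fix t assume t: "t \<in> J" "syzygy (x t)"
  then have "t \<in> range \<tau>" using J(1) by (auto simp: \<tau>(2) syzygy_times_def)
  then obtain n where "t = \<tau> n" by blast
  with t assms(3)[of n] types[of n] show "syzygy_of_type i (x t) \<or> syzygy_of_type j (x t)" by auto
qed

lemma swing:
  assumes "s n \<in> {i, j}" "s (n + 1) \<in> {i, j}"
  shows "\<bar>cos_coord (shape i j k (x (\<tau> (n + 1)))) - cos_coord (shape i j k (x (\<tau> n)))\<bar> = 2"
  using nonstuttering assms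
  by (intro swing_between_syzygies[OF distinct types types]) (auto simp: nonstuttering_def)

lemma close_encounter:
  assumes "e > 0"
  shows "\<exists>L. \<forall>t\<in>einterval a b. L < arcosh (cosh_coord (shape i j k (x t))) \<longrightarrow> dist (x t $ i) (x t $ j) < e"
proof -
  obtain B where "B > 0" "\<forall>t\<in>einterval a b. \<forall>i j. dist (x t $ i) (x t $ j) \<le> B"
    using bounded_solution_distance[OF mass \<mu> sol] by blast
  note B = this
  show ?thesis
    using pair_distance_small[OF no_collision _ _ assms _ B(1)] B(2)
    by (intro exI[of _ "arcosh (2 * B / e + 1)"]) blast
qed

text \<open>
  From the first syzygy after the index \<open>N\<close> on, the motion stays off the slit and swings at every
  syzygy.
\<close>

lemma ends_in_pair_collision:
  assumes N: "\<forall>n>N. s n \<in> {i, j}"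
  shows "ends_in_collision i j b x"
proof (rule ends_in_collisionI[OF time_interval])
  define J where "J = {t \<in> einterval a b. \<tau> (N + 1) \<le> t}"
  have J: "{u..v} \<subseteq> J" if "u \<in> J" "v \<in> J" for u v
    using einterval_convex[of u a b v] that by (auto simp: J_def)
  have J1: "J \<subseteq> einterval a b" by (auto simp: J_def)
  have "s n \<in> {i, j}" if "\<tau> n \<in> J" for n
    using that N strict_mono_less_eq[OF \<tau>(1)] by (auto simp: J_def)
  then obtain w' \<kappa> where "shape_motion (\<lambda>t. shape i j k (x t)) w' J \<kappa>"
    using shape_motion_while_in_pair[OF J1 J] by blast
  then interpret shape_motion "\<lambda>t. shape i j k (x t)" w' J \<kappa> .
  define \<rho> where "\<rho> n = \<tau> (N + 1 + int n)" for n
  have \<rho>: "strict_mono \<rho>" "range \<rho> \<subseteq> J"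
    using \<tau>(1) \<tau>_in by (auto simp: \<rho>_def J_def strict_mono_def strict_mono_less_eq[OF \<tau>(1)])
  have alt: "\<bar>cos_coord (shape i j k (x (\<rho> (Suc n)))) - cos_coord (shape i j k (x (\<rho> n)))\<bar> = 2" for n
    using swing[of "N + 1 + int n"] N by (simp add: \<rho>_def add.assoc add.commute)
  fix e :: real assume "e > 0"
  then obtain L where L: "\<forall>t\<in>einterval a b. L < arcosh (cosh_coord (shape i j k (x t))) \<longrightarrow> dist (x t $ i) (x t $ j) < e"
    using close_encounter by blast
  obtain t0 where t0: "t0 \<in> J" "\<forall>t\<in>J. t0 \<le> t \<longrightarrow> L < arcosh (cosh_coord (shape i j k (x t)))"
    using forward_escape(2)[OF \<rho> alt] by blast
  have "t \<in> J" if "t \<in> einterval a b" "t0 \<le> t" for t using that t0(1) by (auto simp: J_def)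
  then show "\<exists>t0\<in>einterval a b. \<forall>t\<in>einterval a b. t0 \<le> t \<longrightarrow> dist (x t $ i) (x t $ j) < e"
    using t0 L J1 by (intro bexI[of _ t0]) auto
qed

lemma begins_in_pair_collision:
  assumes N: "\<forall>n<N. s n \<in> {i, j}"
  shows "begins_in_collision i j a x"
proof (rule begins_in_collisionI[OF time_interval])
  define J where "J = {t \<in> einterval a b. t \<le> \<tau> (N - 1)}"
  have J: "{u..v} \<subseteq> J" if "u \<in> J" "v \<in> J" for u v
    using einterval_convex[of u a b v] that by (auto simp: J_def)
  have J1: "J \<subseteq> einterval a b" by (auto simp: J_def)
  have "s n \<in> {i, j}" if "\<tau> n \<in> J" for n
    using that N strict_mono_less_eq[OF \<tau>(1)] by (auto simp: J_def)
  then obtain w' \<kappa> where "shape_motion (\<lambda>t. shape i j k (x t)) w' J \<kappa>"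
    using shape_motion_while_in_pair[OF J1 J] by blast
  then interpret shape_motion "\<lambda>t. shape i j k (x t)" w' J \<kappa> .
  define \<rho> where "\<rho> n = - \<tau> (N - 1 - int n)" for n
  have "strict_mono \<rho>" using \<tau>(1) by (auto simp: \<rho>_def strict_mono_def)
  moreover have "range \<rho> \<subseteq> uminus ` J"
    using \<tau>_in by (auto simp: \<rho>_def J_def strict_mono_less_eq[OF \<tau>(1)])
  moreover have "\<bar>cos_coord (shape i j k (x (- \<rho> (Suc n)))) - cos_coord (shape i j k (x (- \<rho> n)))\<bar> = 2" for n
    using swing[of "N - 1 - int (Suc n)"] N by (simp add: \<rho>_def abs_minus_commute algebra_simps)
  ultimately have esc: "\<exists>t\<in>J. \<forall>t'\<in>J. t' \<le> t \<longrightarrow> L < arcosh (cosh_coord (shape i j k (x t')))" for L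
    by (rule backward_escape(2))
  fix e :: real assume "e > 0"
  then obtain L where L: "\<forall>t\<in>einterval a b. L < arcosh (cosh_coord (shape i j k (x t))) \<longrightarrow> dist (x t $ i) (x t $ j) < e"
    using close_encounter by blast
  obtain t0 where t0: "t0 \<in> J" "\<forall>t\<in>J. t \<le> t0 \<longrightarrow> L < arcosh (cosh_coord (shape i j k (x t)))"
    using esc by blast
  have "t \<in> J" if "t \<in> einterval a b" "t \<le> t0" for t using that t0(1) by (auto simp: J_def)
  then show "\<exists>t0\<in>einterval a b. \<forall>t\<in>einterval a b. t \<le> t0 \<longrightarrow> dist (x t $ i) (x t $ j) < e"
    using t0 L J1 by (intro bexI[of _ t0]) auto
qed

text \<open>
  The forward half of the solution gives \<open>d\<sigma>/ds \<ge> 0\<close> and the backward half \<open>d\<sigma>/ds \<le> 0\<close> at all times, but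
  \<open>d\<sigma>/ds\<close> is strictly decreasing.
\<close>

lemma not_confined_to_pair: "\<not> (\<forall>n. s n \<in> {i, j})"
proof
  assume all: "\<forall>n. s n \<in> {i, j}"
  then obtain w' \<kappa> where "shape_motion (\<lambda>t. shape i j k (x t)) w' (einterval a b) \<kappa>"
    using shape_motion_while_in_pair[OF subset_refl einterval_convex] by blast
  then interpret shape_motion "\<lambda>t. shape i j k (x t)" w' "einterval a b" \<kappa> .
  define \<rho> \<rho>' where "\<rho> n = \<tau> (int n)" and "\<rho>' n = - \<tau> (- int n)" for n
  have \<rho>: "strict_mono \<rho>" "range \<rho> \<subseteq> einterval a b" "strict_mono \<rho>'" "range \<rho>' \<subseteq> uminus ` einterval a b"
    using \<tau>(1) \<tau>_in by (auto simp: \<rho>_def \<rho>'_def strict_mono_def)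
  have alt: "\<bar>cos_coord (shape i j k (x (\<rho> (Suc n)))) - cos_coord (shape i j k (x (\<rho> n)))\<bar> = 2" for n
    using swing[of "int n"] all by (simp add: \<rho>_def add.commute)
  have alt': "\<bar>cos_coord (shape i j k (x (- \<rho>' (Suc n)))) - cos_coord (shape i j k (x (- \<rho>' n)))\<bar> = 2" for n
    using swing[of "- int (Suc n)"] all by (simp add: \<rho>'_def abs_minus_commute)
  have "radial_velocity (\<tau> 1) < radial_velocity (\<tau> 0)"
    by (rule forward_escape(3)[OF \<rho>(1,2) alt \<tau>_in \<tau>_in]) (simp add: strict_mono_less[OF \<tau>(1)])
  moreover have "radial_velocity (\<tau> 0) \<le> 0"
    using backward_escape(1)[OF \<rho>(3,4) alt'] \<tau>_in by blast
  moreover have "0 \<le> radial_velocity (\<tau> 1)"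
    using forward_escape(1)[OF \<rho>(1,2) alt] \<tau>_in by blast
  ultimately show False by linarith
qed

end

theorem theorem3:
  fixes m :: "3 \<Rightarrow> real" and i j :: 3
  assumes "m 1 = m 2" and "m 2 = m 3" and "m 3 > 0" and "i \<noteq> j"
  shows "(\<forall>s a b x. nonstuttering s \<and> ends_with i j s \<and> bounded_solution m a b x \<and> realizes a b x s
            \<longrightarrow> ends_in_collision i j b x) \<and>
         (\<forall>s a b x. nonstuttering s \<and> begins_with i j s \<and> bounded_solution m a b x \<and> realizes a b x s
            \<longrightarrow> begins_in_collision i j a x) \<and>
         (\<forall>s. untied i j s \<longrightarrow> \<not> (\<exists>a b x. bounded_solution m a b x \<and> realizes a b x s))"
proof -
  obtain k where k: "i \<noteq> k" "j \<noteq> k" using third_letter[OF assms(4)] by blast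
  have mass: "m l = m 3" for l using exhaust_3[of l] assms(1,2) by auto
  have seq: "\<exists>\<tau>. realized_sequence m (m 3) i j k a b x s \<tau>"
    if "nonstuttering s" "bounded_solution m a b x" "realizes a b x s" for s a b x
    using that assms(3,4) k mass unfolding realizes_def realized_sequence_def by blast
  show ?thesis
  proof (intro conjI allI impI notI; elim conjE exE)
    fix s a b x
    assume "nonstuttering s" "ends_with i j s" "bounded_solution m a b x" "realizes a b x s"
    then show "ends_in_collision i j b x"
      using seq realized_sequence.ends_in_pair_collision unfolding ends_with_def by blast
  next
    fix s a b x
    assume "nonstuttering s" "begins_with i j s" "bounded_solution m a b x" "realizes a b x s"
    then show "begins_in_collision i j a x"
      using seq realized_sequence.begins_in_pair_collision unfolding begins_with_def by blast
  next
    fix s a b x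
    assume "untied i j s" "bounded_solution m a b x" "realizes a b x s"
    then show False
      using seq realized_sequence.not_confined_to_pair unfolding untied_def by blast
  qed
qed

end
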